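(* Let $X(n)$ be a Rademacher or a Steinhaus random multiplicative function and $P_N(\theta)=\frac{1}{\sqrt{N}}\sum_{n=1}^N X(n)e(n\theta)$. Then $$\lim_{N\to\infty}\mathbb{P}\left(\Big(\frac{\log N}{\log\log N}\Big)^{1/6}\le \max_{\theta}|P_N(\theta)|\le \exp\big(3\sqrt{\log N\,\log\log N}\big)\right)=1.$$
   Context: $e(x)=e^{2\pi i x}$. A Rademacher random multiplicative function: for each prime $p$, $X(p)$ are independent random variables taking values $\pm1$ with probability $1/2$ each, and for $n=p_1^{e_1}\cdots p_r^{e_r}$, $X(n)=X(p_1)^{e_1}\cdots X(p_r)^{e_r}$ (completely multiplicative, not restricted to squarefree $n$). A Steinhaus random multiplicative function is defined the same way except the $X(p)$ are independent and uniformly distributed on the complex unit circle. *)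

theory Defs
  imports "HOL-Probability.Probability" "HOL-Computational_Algebra.Primes"
begin

definition e2pi :: "real \<Rightarrow> complex" where
  "e2pi x = exp (2 * of_real pi * \<i> * of_real x)"

(* X 0 is left unconstrained; it is never used. *)
locale random_multiplicative = prob_space M for M :: "'a measure" +
  fixes X :: "nat \<Rightarrow> 'a \<Rightarrow> complex"
  assumes indep_primes: "indep_vars (\<lambda>_. borel) X {p. prime p}"
    and prime_factors_prod: "\<And>n \<omega>. n > 0 \<Longrightarrow> \<omega> \<in> space M \<Longrightarrow>
      X n \<omega> = (\<Prod>p\<in>prime_factors n. X p \<omega> ^ multiplicity p n)"

locale rademacher_multiplicative = random_multiplicative +
  assumes prob_prime_1: "\<And>p. prime p \<Longrightarrow> prob {\<omega> \<in> space M. X p \<omega> = 1} = 1 / 2"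
    and prob_prime_minus_1: "\<And>p. prime p \<Longrightarrow> prob {\<omega> \<in> space M. X p \<omega> = -1} = 1 / 2"

(* The uniform distribution on the complex unit circle is the image of the uniform
   distribution on [0,1] under e2pi. *)
locale steinhaus_multiplicative = random_multiplicative +
  assumes distr_prime: "\<And>p. prime p \<Longrightarrow>
      distr M borel (X p) = distr (uniform_measure lborel {0..1}) borel e2pi"

definition rand_poly :: "(nat \<Rightarrow> 'a \<Rightarrow> complex) \<Rightarrow> nat \<Rightarrow> 'a \<Rightarrow> real \<Rightarrow> complex" where
  "rand_poly X N \<omega> \<theta> = (1 / of_real (sqrt (real N))) * (\<Sum>n=1..N. X n \<omega> * e2pi (real n * \<theta>))"

definition max_rand_poly :: "(nat \<Rightarrow> 'a \<Rightarrow> complex) \<Rightarrow> nat \<Rightarrow> 'a \<Rightarrow> real" where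
  "max_rand_poly X N \<omega> = (SUP \<theta>. norm (rand_poly X N \<omega> \<theta>))"

lemma rand_poly_frac: "rand_poly X N \<omega> (frac \<theta>) = rand_poly X N \<omega> \<theta>"
proof -
  have "e2pi (real n * frac \<theta>) = e2pi (real n * \<theta>)" for n
  proof -
    have "e2pi (real n * \<theta>) = e2pi (real n * frac \<theta> + real_of_int (int n * \<lfloor>\<theta>\<rfloor>))"
      by (simp add: frac_def algebra_simps)
    also have "\<dots> = e2pi (real n * frac \<theta>) * exp (2 * of_real pi * \<i> * of_int (int n * \<lfloor>\<theta>\<rfloor>))"
      unfolding e2pi_def exp_add [symmetric] by (simp add: algebra_simps)
    also have "exp (2 * of_real pi * \<i> * of_int (int n * \<lfloor>\<theta>\<rfloor>)) = 1"
      using exp_integer_2pi[of "of_int (int n * \<lfloor>\<theta>\<rfloor>)"] by (simp add: mult_ac)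
    finally show ?thesis by simp
  qed
  then show ?thesis by (simp add: rand_poly_def)
qed

(* The supremum in max_rand_poly is a maximum. *)
lemma max_rand_poly_attained:
  "\<exists>\<theta>. norm (rand_poly X N \<omega> \<theta>) = max_rand_poly X N \<omega> \<and>
       (\<forall>\<theta>'. norm (rand_poly X N \<omega> \<theta>') \<le> max_rand_poly X N \<omega>)"
proof -
  have "continuous_on {0..1} (\<lambda>\<theta>. norm (rand_poly X N \<omega> \<theta>))"
    unfolding rand_poly_def e2pi_def by (intro continuous_intros)
  then obtain \<theta> where \<theta>: "\<forall>t\<in>{0..1}. norm (rand_poly X N \<omega> t) \<le> norm (rand_poly X N \<omega> \<theta>)"
    using continuous_attains_sup[of "{0..1::real}"] by auto
  have le: "norm (rand_poly X N \<omega> t) \<le> norm (rand_poly X N \<omega> \<theta>)" for t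
  proof -
    have "frac t \<in> {0..1}"
      using frac_lt_1[of t] by simp
    then show ?thesis
      using \<theta> rand_poly_frac[of X N \<omega> t] by metis
  qed
  then have "max_rand_poly X N \<omega> = norm (rand_poly X N \<omega> \<theta>)"
    unfolding max_rand_poly_def by (intro cSup_eq_maximum) auto
  with le show ?thesis by auto
qed

end

theory Submission
  imports Defs "HOL-Number_Theory.Prime_Powers" "HOL-Computational_Algebra.Squarefree"
    "HOL-Real_Asymp.Real_Asymp"
begin

text \<open>
  Both models are invariant under flipping the signs of any set of the \<open>X(p)\<close>, and \<open>|X(p)| = 1\<close>
  almost surely; nothing else is used. Hence the probability of an event is at most the largest
  proportion of sign patterns for which it occurs, over all fixed unimodular values of \<open>X\<close>.

  Upper bound: averaging over the signs at all primes \<open>\<le> N\<close>, the \<open>2k\<close>-th moment at one point is at most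
  \<open>N\<^sup>-\<^sup>k\<close> times the number of \<open>2k\<close>-tuples in \<open>[1, N]\<close> with square product. If \<open>n\<^sub>0 n\<^sub>1 \<dots> n\<^sub>K\<close> is a square,
  then \<open>n\<^sub>0 = b\<^sup>2 a\<^sub>1 \<dots> a\<^sub>K\<close> and \<open>n\<^sub>i = a\<^sub>i m\<^sub>i\<close> with \<open>m\<^sub>1 \<dots> m\<^sub>K\<close> a square, so Rankin's trick gives the
  bound \<open>H\<^sub>N\<close> to the power \<open>k(2k+1)\<close> for the moment. A union bound over \<open>N\<^sup>2\<close> points with
  \<open>k \<approx> (log N / log log N)\<close> to the power \<open>1/2\<close> suffices.

  Lower bound: flip only the primes \<open>p > N\<close> to the power \<open>3/4\<close>. The polynomial is \<open>A + \<Sum> \<epsilon>\<^sub>p H\<^sub>p\<close>, where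
  \<open>H\<^sub>p\<close> only has frequencies \<open>jp\<close> with \<open>j \<le> N/p\<close>. For distinct \<open>p\<close> the functions \<open>Re H\<^sub>p\<close>, and also
  their centred squares, are orthogonal on the grid \<open>a/(8N+1)\<close>; so \<open>\<Sum> (Re H\<^sub>p)\<^sup>2\<close> is of order \<open>N\<close> at most
  grid points, and at most pairs of points the values are almost uncorrelated. Hence the average of
  the Riesz product \<open>\<Prod> (1 + \<epsilon>\<^sub>p \<lambda> Re H\<^sub>p)\<close> over the good points concentrates at its mean 1, and where
  the product is not small, \<open>1 + x \<le> exp (x - x\<^sup>2/4)\<close> forces \<open>\<Sum> \<epsilon>\<^sub>p Re H\<^sub>p\<close> to be large.
\<close>

section \<open>Large prime factors\<close>

text \<open>Chebyshev's identity: write \<open>ln k\<close> as the sum of \<open>mangoldt d\<close>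
  over \<open>d dvd k\<close>, sum over \<open>k\<close> and exchange the order; \<open>d\<close>
  has \<open>n div d\<close> multiples up to \<open>n\<close>.\<close>

lemma ln_fact_eq_sum_mangoldt:
  "ln (fact n) = (\<Sum>d=1..n. mangoldt d * real (n div d))"
proof -
  have card: "card {k\<in>{1..n}. d dvd k} = n div d" if "d \<ge> 1" for d
  proof -
    have "{k\<in>{1..n}. d dvd k} = (\<lambda>j. d * j) ` {1..n div d}"
    proof (intro equalityI subsetI)
      fix k assume "k \<in> {k\<in>{1..n}. d dvd k}"
      then obtain j where "k = d * j" "1 \<le> k" "k \<le> n" by auto
      then show "k \<in> (\<lambda>j. d * j) ` {1..n div d}"
        using that by (auto simp: less_eq_div_iff_mult_less_eq mult.commute)
    next
      fix k assume "k \<in> (\<lambda>j. d * j) ` {1..n div d}"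
      then show "k \<in> {k\<in>{1..n}. d dvd k}"
        using that by (auto simp: less_eq_div_iff_mult_less_eq mult.commute)
    qed
    then show ?thesis
      using that by (simp add: card_image inj_on_def)
  qed
  have "ln (fact n) = (\<Sum>k=1..n. ln (real k))"
    unfolding fact_prod of_nat_prod by (subst ln_prod) auto
  also have "\<dots> = (\<Sum>k=1..n. \<Sum>d | d dvd k. mangoldt d)"
    by (intro sum.cong refl) (simp add: mangoldt_sum)
  also have "\<dots> = (\<Sum>k=1..n. \<Sum>d\<in>{1..n}. if d dvd k then mangoldt d else 0)"
  proof (rule sum.cong [OF refl])
    fix k assume "k \<in> {1..n}"
    then have "{d. d dvd k} = {d\<in>{1..n}. d dvd k}"
      by (auto simp: Suc_le_eq dest: dvd_imp_le intro: Nat.gr0I)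
    then show "(\<Sum>d | d dvd k. mangoldt d) = (\<Sum>d\<in>{1..n}. if d dvd k then mangoldt d else (0::real))"
      by (simp only: sum.inter_filter [OF finite_atLeastAtMost])
  qed
  also have "\<dots> = (\<Sum>d=1..n. \<Sum>k\<in>{1..n}. if d dvd k then mangoldt d else 0)"
    by (rule sum.swap)
  also have "\<dots> = (\<Sum>d=1..n. mangoldt d * real (n div d))"
    by (intro sum.cong refl) (simp add: sum.inter_filter [symmetric] card[simplified] mult.commute)
  finally show ?thesis .
qed

text \<open>Group the prime powers by their prime: \<open>p\<close> has at most
  \<open>log p n\<close> powers up to \<open>n\<close>, each contributing \<open>ln p\<close>, so
  every prime contributes at most \<open>ln n\<close>. This turns a lower bound for Chebyshev's psi
  function into one for the number of primes.\<close>

lemma sum_mangoldt_le: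
  "(\<Sum>d=1..n. mangoldt d) \<le> real (card {p. prime p \<and> p \<le> n}) * ln (real n)"
proof (cases "n = 0")
  case False
  let ?P = "{p. prime p \<and> p \<le> n}"
  let ?D = "{d\<in>{1..n}. primepow d}"
  have fin: "finite ?P" by (rule finite_subset[of _ "{..n}"]) auto
  have "(\<Sum>d=1..n. mangoldt d) = (\<Sum>d\<in>?D. ln (real (aprimedivisor d)))"
    by (intro sum.mono_neutral_cong_right) (auto simp: mangoldt_def)
  also have "\<dots> = (\<Sum>p\<in>?P. \<Sum>d\<in>{d\<in>?D. aprimedivisor d = p}. ln (real (aprimedivisor d)))"
  proof (rule sum.group [symmetric])
    show "aprimedivisor ` ?D \<subseteq> ?P"
    proof
      fix p assume "p \<in> aprimedivisor ` ?D"
      then obtain q k where "prime q" "k > 0" "q ^ k \<le> n" "p = aprimedivisor (q ^ k)"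
        by (auto simp: primepow_def)
      moreover from this have "q \<le> q ^ k"
        by (intro self_le_power) (auto simp: prime_gt_0_nat Suc_le_eq)
      ultimately show "p \<in> ?P" by (simp add: aprimedivisor_prime_power)
    qed
  qed (use fin in auto)
  also have "\<dots> \<le> (\<Sum>p\<in>?P. ln (real n))"
  proof (intro sum_mono)
    fix p assume p: "p \<in> ?P"
    then have p1: "real p > 1" by (auto dest: prime_gt_1_nat)
    define K where "K = nat \<lfloor>log (real p) (real n)\<rfloor>"
    have "{d\<in>?D. aprimedivisor d = p} \<subseteq> (\<lambda>k. p ^ k) ` {1..K}"
    proof
      fix d assume "d \<in> {d\<in>?D. aprimedivisor d = p}"
      then obtain q k where q: "prime q" "k > 0" "q ^ k \<le> n" "p = aprimedivisor (q ^ k)" "d = q ^ k"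
        by (auto simp: primepow_def)
      then have "q = p" by (simp add: aprimedivisor_prime_power)
      then have "p ^ k \<le> n" using q(3) by blast
      then have "real p ^ k \<le> real n" by (metis of_nat_le_iff of_nat_power)
      then have "real k \<le> log (real p) (real n)"
        using p1 False by (subst le_log_iff) (auto simp: powr_realpow)
      then have "k \<le> K" unfolding K_def by linarith
      moreover have "d = p ^ k" "1 \<le> k" using q(2,5) \<open>q = p\<close> by auto
      ultimately show "d \<in> (\<lambda>k. p ^ k) ` {1..K}" by simp
    qed
    then have "card {d\<in>?D. aprimedivisor d = p} \<le> card {1..K}"
      by (intro surj_card_le) auto
    then have "card {d\<in>?D. aprimedivisor d = p} \<le> K" by simp
    then have "real (card {d\<in>?D. aprimedivisor d = p}) * ln p \<le> real K * ln p"
      using p1 by (intro mult_right_mono) auto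
    also have "real K \<le> log p n"
      unfolding K_def using p1 False by (intro of_nat_floor) (auto simp: zero_le_log_cancel_iff)
    then have "real K * ln p \<le> log p n * ln p"
      using p1 by (intro mult_right_mono) auto
    also have "\<dots> = ln n" using p1 by (simp add: log_def)
    finally show "(\<Sum>d\<in>{d\<in>?D. aprimedivisor d = p}. ln (real (aprimedivisor d))) \<le> ln (real n)"
      by (simp add: mult.commute)
  qed
  finally show ?thesis by simp
qed simp

text \<open>The coefficient of \<open>mangoldt d\<close> in
  \<open>ln (fact (2 * n)) - 2 * ln (fact n)\<close> is \<open>2 * n div d - 2 * (n div d)\<close>,
  which is 0 or 1.\<close>

lemma ln_central_binomial_le:
  "ln (real ((2 * n) choose n)) \<le> (\<Sum>d=1..2*n. mangoldt d)"
proof -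
  have "real ((2 * n) choose n) = fact (2 * n) / (fact n * fact n)"
    using binomial_fact[of n "2 * n", where 'a = real] by (simp add: mult_2)
  then have "ln (real ((2 * n) choose n)) = ln (fact (2 * n)) - 2 * ln (fact n)"
    by (simp add: ln_div ln_mult)
  also have "ln (fact n) = (\<Sum>d=1..2*n. mangoldt d * real (n div d))"
    unfolding ln_fact_eq_sum_mangoldt by (intro sum.mono_neutral_left) auto
  also have "ln (fact (2 * n)) - 2 * \<dots> = (\<Sum>d=1..2*n. mangoldt d * (real (2 * n div d) - 2 * real (n div d)))"
    unfolding ln_fact_eq_sum_mangoldt by (simp add: sum_subtractf sum_distrib_left algebra_simps)
  also have "\<dots> \<le> (\<Sum>d=1..2*n. mangoldt d * 1)"
  proof (intro sum_mono mult_left_mono mangoldt_nonneg)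
    fix d assume "d \<in> {1..2*n}"
    then have "2 * n < (2 * (n div d) + 2) * d"
      using dividend_less_times_div[of d n] by (simp add: algebra_simps)
    then have "2 * n div d < 2 * (n div d) + 2"
      by (rule less_mult_imp_div_less)
    then show "real (2 * n div d) - 2 * real (n div d) \<le> 1" by linarith
  qed
  finally show ?thesis by simp
qed

text \<open>Chebyshev's lower bound: the central binomial coefficient is at least
  \<open>4 ^ n / (2 * n)\<close>, and its logarithm is at most the sum of
  \<open>mangoldt\<close>.\<close>

lemma card_primes_ge:
  assumes "x \<ge> 7"
  shows "real x / 4 \<le> real (card {p. prime p \<and> p \<le> x}) * ln (real x)"
proof -
  define n where "n = x div 2"
  have n: "n > 0" "2 * n \<le> x" "real x - 1 \<le> 2 * real n" "2 * n \<noteq> 0" using assms by (auto simp: n_def)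
  \<comment> \<open>The logarithm is absorbed by \<open>ln (x / 4) \<le> x / 4 - 1\<close>. With
    \<open>ln 2 \<ge> 2/3\<close> there remains \<open>x / 2 \<le> (x - 3) * 2/3 + 1\<close>, which
    holds from \<open>x = 6\<close> on.\<close>
  have "real x / 4 \<le> n * ln 4 - ln (2 * real n)"
  proof -
    have "ln (real x / 4) \<le> real x / 4 - 1"
      using assms by (intro ln_le_minus_one) auto
    moreover have "ln (2 * real n) \<le> ln (real x)" using n by simp
    moreover have "ln (real x / 4) = ln (real x) - 2 * ln 2"
      using assms ln_realpow[of "2::real" 2] by (simp add: ln_div)
    moreover have "ln (4::real) = 2 * ln 2" using ln_realpow[of "2::real" 2] by simp
    moreover have "(real x - 1) * ln 2 \<le> 2 * real n * ln 2" using n by (intro mult_right_mono) auto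
    moreover have "(real x - 3) * (2/3) \<le> (real x - 3) * ln 2"
      using assms ln2_ge_two_thirds by (intro mult_left_mono) auto
    moreover have "real x \<ge> 7" using assms by simp
    ultimately show ?thesis by (simp only: algebra_simps)
  qed
  also have "\<dots> = ln (4 ^ n / (2 * real n))" using n by (simp add: ln_div ln_realpow)
  also have "\<dots> \<le> ln (real ((2 * n) choose n))"
    using central_binomial_lower_bound[OF n(1)] n by (subst ln_le_cancel_iff) auto
  also have "\<dots> \<le> (\<Sum>d=1..2*n. mangoldt d)" by (rule ln_central_binomial_le)
  also have "\<dots> \<le> (\<Sum>d=1..x. mangoldt d)" using n by (intro sum_mono2) (auto simp: mangoldt_nonneg)
  also have "\<dots> \<le> real (card {p. prime p \<and> p \<le> x}) * ln (real x)" by (rule sum_mangoldt_le)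
  finally show ?thesis .
qed

text \<open>The primes in \<open>(N powr (3/4), N]\<close>, written without real powers. The
  exponent makes \<open>N div p\<close> smaller than \<open>N powr (1/4)\<close>, so cofactors of
  large primes are too small to contain another large prime, and the sum of
  \<open>(N div p) ^ 4\<close> is small against \<open>N^2\<close>.\<close>

definition large_primes :: "nat \<Rightarrow> nat set" where
  "large_primes N = {p. prime p \<and> p \<le> N \<and> N ^ 3 < p ^ 4}"

lemma finite_large_primes [simp]: "finite (large_primes N)"
  by (rule finite_subset[of _ "{..N}"]) (auto simp: large_primes_def)

text \<open>Count the pairs \<open>(p, j)\<close> with \<open>j * p \<le> N\<close> by
  \<open>j\<close> first. For each \<open>j \<le> J\<close> Chebyshev's bound at
  \<open>N div j\<close> gives about \<open>N / (4 * j * ln N)\<close> primes, of which at most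
  \<open>N powr (3/4)\<close> are not large; the harmonic sum over \<open>j\<close> produces
  \<open>ln (J + 1)\<close>.\<close>

lemma sum_large_primes_ge:
  assumes "N \<ge> 16" "7 * J \<le> N"
  shows "(\<Sum>p\<in>large_primes N. real (N div p)) \<ge>
    real N * ln (real J + 1) / (4 * ln (real N)) - real J * (1 + real N powr (3/4))"
proof -
  let ?P = "large_primes N"
  \<comment> \<open>All positive integers up to the threshold, prime or not: this crude count is
    already of lower order.\<close>
  define S where "S = {p. 0 < p \<and> p ^ 4 \<le> N ^ 3}"
  have lnN: "ln (real N) \<ge> 1"
    using assms exp_le by (subst ln_ge_iff) auto
  have Sle: "real p \<le> real N powr (3/4)" if "p \<in> S" for p
  proof -
    have "real p ^ 4 \<le> real N ^ 3"
      using that unfolding S_def by (metis (mono_tags, lifting) mem_Collect_eq of_nat_le_iff of_nat_power)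
    then have "(real p ^ 4) powr (1/4) \<le> (real N ^ 3) powr (1/4)" by (intro powr_mono2) auto
    moreover have "(real p ^ 4) powr (1/4) = real p"
      using that powr_powr[of "real p" 4 "1/4"] by (simp add: S_def)
    moreover have "(real N ^ 3) powr (1/4) = real N powr (3/4)"
      using assms powr_powr[of "real N" 3 "1/4"] by simp
    ultimately show ?thesis by simp
  qed
  have Ssub: "S \<subseteq> {1..nat \<lfloor>real N powr (3/4)\<rfloor>}"
    using Sle by (auto simp: le_nat_floor S_def)
  have finS: "finite S" by (rule finite_subset[OF Ssub]) auto
  have "real (card S) \<le> real (nat \<lfloor>real N powr (3/4)\<rfloor>)"
    using card_mono[OF _ Ssub] by (subst of_nat_le_iff) simp
  also have "\<dots> \<le> real N powr (3/4)" by (intro of_nat_floor) auto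
  finally have cardS: "real (card S) \<le> real N powr (3/4)" .
  have pj: "real (card {p\<in>?P. p \<le> N div j}) \<ge> real N / j / (4 * ln N) - 1 - real N powr (3/4)"
    if j: "j \<in> {1..J}" for j
  proof -
    let ?x = "N div j"
    have "7 * j \<le> N" using j assms by auto
    then have x: "7 \<le> ?x" using j by (simp add: less_eq_div_iff_mult_less_eq)
    have "?x \<le> N" by simp
    have "N < (?x + 1) * j" using j dividend_less_div_times[of j N] by simp
    then have "real N \<le> (real ?x + 1) * real j"
      by (metis less_imp_le of_nat_1 of_nat_add of_nat_le_iff of_nat_mult)
    then have "real N / j \<le> real ?x + 1" using j by (simp add: divide_le_eq)
    then have "real N / j / (4 * ln N) \<le> (real ?x + 1) / (4 * ln N)"
      using lnN by (intro divide_right_mono) auto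
    also have "\<dots> \<le> real ?x / 4 / ln N + 1"
      using lnN by (simp add: field_simps)
    also have "real ?x / 4 / ln N \<le> real (card {p. prime p \<and> p \<le> ?x})"
    proof -
      have "real ?x / 4 \<le> real (card {p. prime p \<and> p \<le> ?x}) * ln (real ?x)"
        by (rule card_primes_ge[OF x])
      also have "\<dots> \<le> real (card {p. prime p \<and> p \<le> ?x}) * ln (real N)"
        using x \<open>?x \<le> N\<close> by (intro mult_left_mono ln_mono) (simp_all only: of_nat_le_iff of_nat_0_less_iff of_nat_0_le_iff)
      finally show ?thesis using lnN by (simp add: field_simps)
    qed
    also have "card {p. prime p \<and> p \<le> ?x} \<le> card ({p\<in>?P. p \<le> ?x} \<union> S)"
      using finS le_trans[OF _ \<open>?x \<le> N\<close>]
      by (intro card_mono) (auto simp: large_primes_def S_def prime_gt_0_nat not_less)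
    also have "\<dots> \<le> card {p\<in>?P. p \<le> ?x} + card S" by (rule card_Un_le)
    finally show ?thesis using cardS by simp
  qed
  have harm: "ln (real J + 1) \<le> (\<Sum>j=1..J. 1 / real j)"
    using ln_le_harm[of J] by (simp add: harm_def inverse_eq_divide)
  have "real N * ln (real J + 1) / (4 * ln (real N)) - real J * (1 + real N powr (3/4))
     \<le> real N * (\<Sum>j=1..J. 1 / real j) / (4 * ln (real N)) - real J * (1 + real N powr (3/4))"
    using lnN harm by (intro diff_right_mono divide_right_mono mult_left_mono) auto
  also have "\<dots> = (\<Sum>j=1..J. real N / j / (4 * ln N) - 1 - real N powr (3/4))"
    by (simp add: sum_subtractf sum_distrib_left sum_divide_distrib algebra_simps)
  also have "\<dots> \<le> (\<Sum>j=1..J. real (card {p\<in>?P. p \<le> N div j}))"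
    by (intro sum_mono pj)
  also have "\<dots> = (\<Sum>j=1..J. \<Sum>p\<in>?P. if p \<le> N div j then 1 else 0)"
    by (simp add: sum.inter_filter [symmetric])
  also have "\<dots> = (\<Sum>p\<in>?P. \<Sum>j=1..J. if p \<le> N div j then 1 else 0)"
    by (rule sum.swap)
  also have "\<dots> \<le> (\<Sum>p\<in>?P. real (N div p))"
  proof (intro sum_mono)
    fix p assume "p \<in> ?P"
    then have p: "p > 0" by (auto simp: large_primes_def prime_gt_0_nat)
    have "(\<Sum>j=1..J. if p \<le> N div j then 1 else 0) = real (card {j\<in>{1..J}. p \<le> N div j})"
      by (simp add: sum.inter_filter [symmetric])
    also have "card {j\<in>{1..J}. p \<le> N div j} \<le> card {1..N div p}"
      using p by (intro card_mono) (auto simp: less_eq_div_iff_mult_less_eq mult.commute)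
    finally show "(\<Sum>j=1..J. if p \<le> N div j then 1 else 0) \<le> real (N div p)" by simp
  qed
  finally show ?thesis .
qed

text \<open>Since \<open>J\<close> is a power of \<open>N\<close>, the factor
  \<open>ln (J + 1)\<close> cancels \<open>ln N\<close> and a positive proportion of
  \<open>N\<close> results. With \<open>J\<close> about \<open>N powr (1/8)\<close> the main term is
  \<open>N / 32\<close>; the error has order \<open>N powr (7/8)\<close> and takes at most half of
  it.\<close>

lemma eventually_sum_large_primes_ge:
  "\<forall>\<^sub>F N in sequentially. real N / 64 \<le> (\<Sum>p\<in>large_primes N. real (N div p))"
proof -
  have ev1: "\<forall>\<^sub>F N::nat in sequentially. 7 * real N powr (1/8) \<le> real N" by real_asymp
  have ev2: "\<forall>\<^sub>F N::nat in sequentially.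
     real N / 64 \<le> real N / 32 - real N powr (1/8) * (1 + real N powr (3/4))" by real_asymp
  show ?thesis using ev1 ev2 eventually_ge_at_top[of 16]
  proof eventually_elim
    case (elim N)
    define J where "J = nat \<lfloor>real N powr (1/8)\<rfloor>"
    have J: "real J \<le> real N powr (1/8)" "real N powr (1/8) \<le> real J + 1"
      unfolding J_def by (auto intro!: of_nat_floor)
    have "ln (real N) / 8 = ln (real N powr (1/8))" using elim by (simp add: ln_powr)
    also have "\<dots> \<le> ln (real J + 1)" using J elim by (subst ln_le_cancel_iff) auto
    finally have lnJ: "ln (real N) / 8 \<le> ln (real J + 1)" .
    have "ln (real N) > 0" using elim by simp
    have "real N / 64 \<le> real N * (ln (real N) / 8) / (4 * ln (real N)) - real N powr (1/8) * (1 + real N powr (3/4))"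
      using elim \<open>ln (real N) > 0\<close> by simp
    also have "\<dots> \<le> real N * ln (real J + 1) / (4 * ln (real N)) - real J * (1 + real N powr (3/4))"
      using lnJ J \<open>ln (real N) > 0\<close> elim
      by (intro diff_mono divide_right_mono mult_left_mono mult_right_mono) auto
    also have "\<dots> \<le> (\<Sum>p\<in>large_primes N. real (N div p))"
    proof (rule sum_large_primes_ge)
      show "7 * J \<le> N" using elim J by linarith
    qed (use elim J in auto)
    finally show ?case .
  qed
qed

section \<open>Tuples with square product and even moments\<close>

lemma power_sum_eq_sum_lists:
  fixes f :: "'b \<Rightarrow> 'c::comm_semiring_1"
  assumes "finite A"
  shows "(\<Sum>a\<in>A. f a) ^ n = (\<Sum>xs | set xs \<subseteq> A \<and> length xs = n. prod_list (map f xs))"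
proof (induction n)
  case 0
  have "{xs. set xs \<subseteq> A \<and> length xs = 0} = {[]}" by auto
  then show ?case by simp
next
  case (Suc n)
  have "(\<Sum>xs | set xs \<subseteq> A \<and> length xs = Suc n. prod_list (map f xs))
      = (\<Sum>(xs, a)\<in>{xs. set xs \<subseteq> A \<and> length xs = n} \<times> A. prod_list (map f (a # xs)))"
    unfolding lists_length_Suc_eq by (subst sum.reindex) (auto simp: inj_on_def case_prod_unfold)
  also have "\<dots> = (\<Sum>xs | set xs \<subseteq> A \<and> length xs = n. \<Sum>a\<in>A. f a * prod_list (map f xs))"
    by (subst sum.cartesian_product) simp
  also have "\<dots> = (\<Sum>a\<in>A. f a) * (\<Sum>a\<in>A. f a) ^ n"
    unfolding Suc.IH sum_product by (rule sum.swap)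
  finally show ?case by simp
qed

definition square_lists :: "nat \<Rightarrow> nat \<Rightarrow> nat list set" where
  "square_lists N K = {ns. set ns \<subseteq> {1..N} \<and> length ns = K \<and> (\<exists>c. prod_list ns = c ^ 2)}"

lemma finite_square_lists [simp]: "finite (square_lists N K)"
  by (rule finite_subset[OF _ finite_lists_length_eq[of "{1..N}" K]]) (auto simp: square_lists_def)

lemma prod_list_map2_mult:
  fixes xs ys :: "'b::comm_monoid_mult list"
  assumes "length xs = length ys"
  shows "prod_list (map2 (*) xs ys) = prod_list xs * prod_list ys"
  using assms by (induction xs ys rule: list_induct2) (auto simp: mult_ac)

text \<open>\<open>division_decomp\<close> splits off the part of \<open>q\<close> that divides the
  first factor; the rest is handled by induction.\<close>

lemma dvd_prod_list_decomp:
  fixes q :: nat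
  assumes "q dvd prod_list ns"
  shows "\<exists>as ms. length as = length ns \<and> length ms = length ns \<and> prod_list as = q \<and> ns = map2 (*) as ms"
  using assms
proof (induction ns arbitrary: q)
  case Nil
  then show ?case by simp
next
  case (Cons n ns)
  then obtain b c where bc: "q = b * c" "b dvd n" "c dvd prod_list ns"
    using division_decomp[of q n "prod_list ns"] by auto
  obtain m where m: "n = b * m" using bc by auto
  obtain as ms where am: "length as = length ns" "length ms = length ns" "prod_list as = c" "map2 (*) as ms = ns"
    using Cons.IH[OF bc(3)] by blast
  have "length (b # as) = length (n # ns) \<and> length (m # ms) = length (n # ns) \<and>
      prod_list (b # as) = q \<and> n # ns = map2 (*) (b # as) (m # ms)"
    by (simp add: am bc(1) m)
  then show ?case by - (rule exI, rule exI)
qed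

text \<open>Write \<open>n = b^2 * q\<close> with \<open>q\<close> squarefree. After cancelling
  \<open>b^2\<close>, the number \<open>q * prod_list ns\<close> is still a square, and
  \<open>q\<close> divides its root because \<open>q\<close> is squarefree. Hence
  \<open>prod_list ns = q * d^2\<close>, and distributing \<open>q\<close> over the entries of
  \<open>ns\<close> as \<open>as\<close> leaves cofactors \<open>ms\<close> with product
  \<open>d^2\<close>.\<close>

lemma square_list_decomp:
  fixes n :: nat
  assumes "prod_list (n # ns) = c ^ 2" "n > 0"
  obtains b as ms d where "n = b ^ 2 * prod_list as" "length as = length ns" "length ms = length ns"
    "ns = map2 (*) as ms" "prod_list ms = d ^ 2"
proof -
  define q b where "q = squarefree_part n" and "b = square_part n"
  have n: "n = b ^ 2 * q" using squarefree_decompose[of n] by (simp add: q_def b_def mult.commute)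
  have sf: "squarefree q" by (simp add: q_def)
  have pos: "b > 0" "q > 0" using n assms(2) by (auto intro: Nat.gr0I)
  have "b ^ 2 dvd c ^ 2" using assms(1) n by (metis dvd_triv_left mult.assoc prod_list.Cons)
  then obtain c' where c': "c = b * c'" by auto
  with assms(1) n pos have eq: "q * prod_list ns = c' ^ 2"
    by (simp add: power_mult_distrib)
  \<comment> \<open>Compare multiplicities: a prime occurs in \<open>q\<close> at most once, and if
    it occurs then it divides \<open>c'^2\<close> and hence \<open>c'\<close>.\<close>
  have "q dvd c'"
  proof (cases "c' = 0")
    case c'0: False
    show ?thesis
    proof (rule multiplicity_le_imp_dvd)
      show "q \<noteq> 0" using pos by simp
      fix p :: nat assume p: "prime p"
      show "multiplicity p q \<le> multiplicity p c'"
      proof (cases "multiplicity p q = 0")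
        case False
        have "multiplicity p q \<le> 1"
          using sf p pos by (auto simp: squarefree_factorial_semiring' q_def prime_multiplicity_squarefree_part)
        moreover have "p dvd c'"
        proof -
          have "p dvd q" using False not_dvd_imp_multiplicity_0[of p q] by auto
          then have "p dvd c' ^ 2" using eq by (metis dvd_mult2)
          with p show ?thesis by (rule prime_dvd_power)
        qed
        then have "multiplicity p c' \<ge> 1"
          using c'0 p by (intro multiplicity_geI) auto
        ultimately show ?thesis by simp
      qed simp
    qed
  qed simp
  then obtain d where "c' = q * d" by auto
  with eq pos have eq2: "prod_list ns = q * d ^ 2" by (simp add: power2_eq_square)
  then obtain as ms where am: "length as = length ns" "length ms = length ns" "prod_list as = q" "ns = map2 (*) as ms"
    using dvd_prod_list_decomp[of q ns] dvd_triv_left[of q "d ^ 2"] by (simp only:) blast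
  have "prod_list as * prod_list ms = q * d ^ 2"
    using eq2 prod_list_map2_mult[of as ms] unfolding am(1,2) am(4) [symmetric] by simp
  then have "prod_list ms = d ^ 2" using am(3) pos by simp
  with that n am show ?thesis by blast
qed

text \<open>The weight of Rankin's trick: on lists of length \<open>2 * k\<close> with entries from
  1 to \<open>N\<close> it is at least \<open>1 / N ^ k\<close>, so a weighted sum controls the
  number of lists.\<close>

definition inv_sqrt_weight :: "nat list \<Rightarrow> real" where
  "inv_sqrt_weight ns = prod_list (map (\<lambda>n. 1 / sqrt (real n)) ns)"

lemma inv_sqrt_weight_map2:
  assumes "length xs = length ys"
  shows "inv_sqrt_weight (map2 (*) xs ys) = inv_sqrt_weight xs * inv_sqrt_weight ys"
  using assms by (induction xs ys rule: list_induct2) (auto simp: inv_sqrt_weight_def real_sqrt_mult)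

lemma inv_sqrt_weight_eq: "inv_sqrt_weight ns = 1 / sqrt (real (prod_list ns))"
  by (induction ns) (auto simp: inv_sqrt_weight_def real_sqrt_mult)

text \<open>Induction on the length. By \<open>square_list_decomp\<close> a list of length
  \<open>K + 1\<close> is described by \<open>b\<close>, the \<open>K\<close> entries of
  \<open>as\<close> and a shorter square list \<open>ms\<close>. The weight factorises, and each of
  these \<open>K + 1\<close> free variables contributes a factor \<open>harm N\<close>, so the
  exponent is \<open>1 + 2 + ... + K\<close> for length \<open>K\<close>.\<close>

lemma sum_inv_sqrt_weight_square_lists_le:
  "(\<Sum>ns\<in>square_lists N K. inv_sqrt_weight ns) \<le> (harm N) ^ (K * (K + 1) div 2)"
proof (induction K)
  case 0
  have "square_lists N 0 = {[]}" by (auto simp: square_lists_def intro: exI[of _ 1])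
  then show ?case by (simp add: inv_sqrt_weight_def)
next
  case (Suc K)
  define A where "A = {as. set as \<subseteq> {1..N} \<and> length as = K}"
  define D where "D = {1..N} \<times> A \<times> square_lists N K"
  define h where "h = (\<lambda>(b::nat, as, ms). (b ^ 2 * prod_list as) # map2 (*) as ms)"
  have fin: "finite A" unfolding A_def by (rule finite_lists_length_eq) simp
  have finD: "finite D" using fin by (simp add: D_def)
  \<comment> \<open>Covering the square lists is enough: the weights are nonnegative, so neither
    repeated values of \<open>h\<close> nor values outside the square lists hurt an upper
    bound.\<close>
  have sub: "square_lists N (Suc K) \<subseteq> h ` D"
  proof
    fix xs assume xs: "xs \<in> square_lists N (Suc K)"
    then obtain n ns where xs_eq: "xs = n # ns" by (cases xs) (auto simp: square_lists_def)
    obtain c where c: "prod_list (n # ns) = c ^ 2" and n: "n > 0" "n \<le> N" and ns: "set ns \<subseteq> {1..N}" "length ns = K"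
      using xs by (auto simp: square_lists_def xs_eq)
    obtain b as ms d where d: "n = b ^ 2 * prod_list as" "length as = length ns" "length ms = length ns"
       "ns = map2 (*) as ms" "prod_list ms = d ^ 2"
      using square_list_decomp[OF c n(1)] .
    have "b > 0" "b \<le> b ^ 2 * prod_list as" "prod_list as > 0"
      using d(1) n by (auto intro!: Nat.gr0I simp: power2_eq_square)
    then have b: "b \<in> {1..N}" using n(2) d(1) by simp
    have am: "a \<in> {1..N} \<and> m \<in> {1..N}" if "(a, m) \<in> set (zip as ms)" for a m
    proof -
      have "a * m \<in> set ns" using that d(4) by (auto simp: image_iff case_prod_unfold intro: bexI[of _ "(a, m)"])
      then have "1 \<le> a * m" "a * m \<le> N" using ns by auto
      moreover from this have "a > 0" "m > 0" by (auto intro: Nat.gr0I)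
      moreover from this have "a \<le> a * m" "m \<le> a * m" by auto
      ultimately show ?thesis unfolding atLeastAtMost_iff by linarith
    qed
    have "set as \<subseteq> {1..N}" "set ms \<subseteq> {1..N}"
      using am set_zip_leftD set_zip_rightD d(2,3) by (metis subsetI in_set_impl_in_set_zip1 in_set_impl_in_set_zip2)+
    then have "(b, as, ms) \<in> D" using b d(2,3,5) ns(2) by (auto simp: D_def A_def square_lists_def)
    moreover have "xs = h (b, as, ms)" unfolding h_def using xs_eq d(1,4) by simp
    ultimately show "xs \<in> h ` D" by blast
  qed
  have nonneg: "inv_sqrt_weight xs \<ge> 0" for xs by (simp add: inv_sqrt_weight_eq)
  have "(\<Sum>ns\<in>square_lists N (Suc K). inv_sqrt_weight ns) \<le> (\<Sum>ns\<in>h ` D. inv_sqrt_weight ns)"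
    using finD sub nonneg by (intro sum_mono2) auto
  also have "\<dots> \<le> (\<Sum>x\<in>D. inv_sqrt_weight (h x))"
    using sum_image_le[OF finD, of inv_sqrt_weight h] nonneg by simp
  also have "\<dots> = (\<Sum>(b, as, ms)\<in>D. 1 / real b * (prod_list (map (\<lambda>a. 1 / real a) as) * inv_sqrt_weight ms))"
  proof (intro sum.cong refl, clarsimp)
    fix b as ms assume "(b, as, ms) \<in> D"
    then have l: "length as = length ms" by (auto simp: D_def A_def square_lists_def)
    \<comment> \<open>Each entry of \<open>as\<close> divides both the head of the list and one
      entry of the tail, so its two factors \<open>1 / sqrt a\<close> combine to
      \<open>1 / a\<close>.\<close>
    have sq: "inv_sqrt_weight as * inv_sqrt_weight as = prod_list (map (\<lambda>a. 1 / real a) as)"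
      by (induction as) (auto simp: inv_sqrt_weight_def)
    have "inv_sqrt_weight (h (b, as, ms)) = 1 / sqrt (real (b ^ 2 * prod_list as)) * inv_sqrt_weight (map2 (*) as ms)"
      by (simp add: h_def inv_sqrt_weight_def)
    also have "\<dots> = 1 / real b * (inv_sqrt_weight as * inv_sqrt_weight as) * inv_sqrt_weight ms"
      using inv_sqrt_weight_map2[OF l] by (simp add: real_sqrt_mult inv_sqrt_weight_eq[of as])
    finally show "inv_sqrt_weight (h (b, as, ms)) = prod_list (map (\<lambda>a. 1 / real a) as) * inv_sqrt_weight ms / real b"
      unfolding sq by simp
  qed
  also have "\<dots> = (\<Sum>b=1..N. 1 / real b) * ((\<Sum>as\<in>A. prod_list (map (\<lambda>a. 1 / real a) as)) * (\<Sum>ms\<in>square_lists N K. inv_sqrt_weight ms))"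
    unfolding D_def by (simp only: sum.cartesian_product [symmetric] sum_product) (simp only: sum_distrib_left)
  also have "(\<Sum>as\<in>A. prod_list (map (\<lambda>a. 1 / real a) as)) = (\<Sum>b=1..N. 1 / real b) ^ K"
    unfolding A_def by (rule power_sum_eq_sum_lists [symmetric]) simp
  also have "(\<Sum>b=1..N. 1 / real b) = harm N" by (simp add: harm_def inverse_eq_divide)
  also have "harm N * (harm N ^ K * (\<Sum>ms\<in>square_lists N K. inv_sqrt_weight ms))
      \<le> harm N * (harm N ^ K * harm N ^ (K * (K + 1) div 2))"
    using Suc.IH by (intro mult_left_mono) (auto simp: harm_nonneg)
  also have "\<dots> = harm N ^ (Suc K + K * (K + 1) div 2)" by (simp add: power_add)
  also have "Suc K + K * (K + 1) div 2 = Suc K * (Suc K + 1) div 2" by simp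
  finally show ?case .
qed

text \<open>Rankin's trick: every list counted has
  \<open>sqrt N ^ (2 * k) * inv_sqrt_weight ns \<ge> 1\<close>.\<close>

lemma card_square_lists_le:
  "real (card (square_lists N (2 * k))) \<le> real N ^ k * harm N ^ (k * (2 * k + 1))"
proof -
  have "1 \<le> sqrt (real N) ^ (2 * k) * inv_sqrt_weight ns" if "ns \<in> square_lists N (2 * k)" for ns
  proof -
    have "real (prod_list ns) \<le> real N ^ length ns \<and> prod_list ns > 0" if "set ns \<subseteq> {1..N}" for ns
      using that by (induction ns) (auto intro!: mult_mono)
    then have *: "real (prod_list ns) \<le> real N ^ (2 * k)" "prod_list ns > 0"
      using that by (fastforce simp: square_lists_def)+
    then have "sqrt (real (prod_list ns)) \<le> sqrt (real N ^ (2 * k))" by simp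
    then show ?thesis
      using *(2) by (simp add: inv_sqrt_weight_eq real_sqrt_power)
  qed
  then have "(\<Sum>ns\<in>square_lists N (2 * k). 1) \<le> (\<Sum>ns\<in>square_lists N (2 * k). sqrt (real N) ^ (2 * k) * inv_sqrt_weight ns)"
    by (intro sum_mono) auto
  also have "\<dots> = real N ^ k * (\<Sum>ns\<in>square_lists N (2 * k). inv_sqrt_weight ns)"
    by (simp add: sum_distrib_left power_mult)
  also have "\<dots> \<le> real N ^ k * harm N ^ (2 * k * (2 * k + 1) div 2)"
    by (intro mult_left_mono sum_inv_sqrt_weight_square_lists_le) auto
  also have "2 * k * (2 * k + 1) div 2 = k * (2 * k + 1)" by simp
  finally show ?thesis by simp
qed

text \<open>For a finite set \<open>T\<close> of primes this is, on positive integers, the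
  completely multiplicative function with value \<open>- 1\<close> at the primes in \<open>T\<close>
  and 1 at all others. Multiplying \<open>X\<close> by it flips the sign of \<open>X p\<close>
  exactly for \<open>p \<in> T\<close>.\<close>

definition flip :: "nat set \<Rightarrow> nat \<Rightarrow> real" where
  "flip T n = (\<Prod>p\<in>T. (-1) ^ multiplicity p n)"

lemma abs_flip [simp]: "\<bar>flip T n\<bar> = 1"
  by (simp add: flip_def abs_prod power_abs)

lemma flip_mult:
  assumes "\<And>p. p \<in> T \<Longrightarrow> prime p" "m > 0" "n > 0"
  shows "flip T (m * n) = flip T m * flip T n"
  unfolding flip_def prod.distrib [symmetric]
  using assms by (intro prod.cong refl) (simp add: prime_elem_multiplicity_mult_distrib power_add)

lemma flip_1 [simp]: "flip T (Suc 0) = 1"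
  using multiplicity_one by (simp add: flip_def)

lemma flip_prod_list:
  assumes "\<And>p. p \<in> T \<Longrightarrow> prime p" "0 \<notin> set ns"
  shows "flip T (prod_list ns) = prod_list (map (flip T) ns)"
  using assms(2)
proof (induction ns)
  case (Cons n ns)
  then have "prod_list ns > 0" "n > 0" by (auto intro!: Nat.gr0I simp: prod_list_zero_iff)
  with Cons show ?case by (simp add: flip_mult[OF assms(1)])
qed simp

lemma sum_flip_eq_prod:
  assumes "finite I"
  shows "(\<Sum>T\<in>Pow I. flip T n) = (\<Prod>p\<in>I. 1 + (-1) ^ multiplicity p n)"
  using prod_add[OF assms, of "\<lambda>p. (-1) ^ multiplicity p n" "\<lambda>_. 1 :: real"]
  by (simp add: flip_def add.commute)

text \<open>A nonsquare has a prime of odd multiplicity, whose factor \<open>1 + (- 1)\<close> in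
  \<open>sum_flip_eq_prod\<close> vanishes.\<close>

lemma sum_flip_eq_0:
  assumes "finite I" "n > 0" "prime_factors n \<subseteq> I" "\<nexists>c. n = c ^ 2"
  shows "(\<Sum>T\<in>Pow I. flip T n) = 0"
proof -
  have "\<exists>p\<in>prime_factors n. odd (multiplicity p n)"
  proof (rule ccontr)
    assume "\<not> ?thesis"
    then have "p ^ multiplicity p n = (p ^ (multiplicity p n div 2)) ^ 2" if "p \<in> prime_factors n" for p
      using that by (auto simp: power_mult [symmetric] elim!: evenE)
    then have "(\<Prod>p\<in>prime_factors n. p ^ multiplicity p n) = (\<Prod>p\<in>prime_factors n. p ^ (multiplicity p n div 2)) ^ 2"
      by (simp add: prod_power_distrib)
    then show False using assms(2,4) prime_factorization_nat[of n] by metis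
  qed
  then obtain p where "p \<in> I" "odd (multiplicity p n)" using assms(3) by auto
  then show ?thesis unfolding sum_flip_eq_prod[OF assms(1)] using assms(1)
    by (intro prod_zero bexI[of _ p]) auto
qed

text \<open>Expand \<open>norm z ^ (2 * k) = z ^ k * cnj (z ^ k)\<close> over pairs of lists. The
  signs are real and multiplicative, so a pair carries the sign of the product of the concatenated
  list. Summing over \<open>T\<close> kills all pairs for which this product is not a square; every
  other pair contributes at most \<open>2 ^ card I\<close>.\<close>

lemma sum_flip_moment_le:
  fixes g :: "nat \<Rightarrow> complex"
  assumes g: "\<And>n. n \<in> {1..N} \<Longrightarrow> norm (g n) \<le> 1"
  defines "I \<equiv> {p. prime p \<and> p \<le> N}"
  shows "(\<Sum>T\<in>Pow I. norm (\<Sum>n=1..N. of_real (flip T n) * g n) ^ (2 * k))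
     \<le> 2 ^ card I * real (card (square_lists N (2 * k)))"
proof -
  have finI: "finite I" unfolding I_def by (rule finite_subset[of _ "{..N}"]) auto
  define L where "L = {xs. set xs \<subseteq> {1..N} \<and> length xs = k}"
  have finL: "finite L" unfolding L_def by (rule finite_lists_length_eq) simp
  define G where "G = (\<lambda>xs ys. prod_list (map g xs) * cnj (prod_list (map g ys)))"
  have G: "norm (G xs ys) \<le> 1" if "xs \<in> L" "ys \<in> L" for xs ys
  proof -
    have "norm (prod_list (map g xs)) \<le> 1" if "set xs \<subseteq> {1..N}" for xs
      using that by (induction xs) (auto simp: norm_mult intro!: mult_le_one g)
    then show ?thesis using that by (auto simp: L_def G_def norm_mult intro!: mult_le_one)
  qed
  have cnj_pl: "cnj (prod_list zs) = prod_list (map cnj zs)" for zs by (induction zs) auto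
  have expand: "complex_of_real (norm (\<Sum>n=1..N. of_real (flip T n) * g n) ^ (2 * k))
      = (\<Sum>(xs, ys)\<in>L \<times> L. of_real (flip T (prod_list (xs @ ys))) * G xs ys)" if T: "T \<in> Pow I" for T
  proof -
    define z where "z = (\<Sum>n=1..N. of_real (flip T n) * g n)"
    have TP: "\<And>p. p \<in> T \<Longrightarrow> prime p" using T by (auto simp: I_def)
    have zk: "z ^ k = (\<Sum>xs\<in>L. of_real (flip T (prod_list xs)) * prod_list (map g xs))"
    proof -
      have "z ^ k = (\<Sum>xs\<in>L. prod_list (map (\<lambda>n. of_real (flip T n) * g n) xs))"
        unfolding z_def L_def by (rule power_sum_eq_sum_lists) simp
      also have "\<dots> = (\<Sum>xs\<in>L. of_real (flip T (prod_list xs)) * prod_list (map g xs))"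
      proof (intro sum.cong refl)
        fix xs assume "xs \<in> L"
        then have "0 \<notin> set xs" by (auto simp: L_def)
        then have "flip T (prod_list xs) = prod_list (map (flip T) xs)"
          using flip_prod_list[OF TP] by simp
        moreover have "prod_list (map (\<lambda>n. of_real (flip T n) * g n) xs)
            = of_real (prod_list (map (flip T) xs)) * prod_list (map g xs)"
          by (induction xs) auto
        ultimately show "prod_list (map (\<lambda>n. of_real (flip T n) * g n) xs)
            = of_real (flip T (prod_list xs)) * prod_list (map g xs)" by simp
      qed
      finally show ?thesis .
    qed
    have "complex_of_real (norm z ^ (2 * k)) = (z * cnj z) ^ k"
      by (simp add: power_mult complex_norm_square [symmetric])
    also have "\<dots> = z ^ k * cnj (z ^ k)" by (simp add: power_mult_distrib)
    also have "\<dots> = (\<Sum>(xs, ys)\<in>L \<times> L. (of_real (flip T (prod_list xs)) * prod_list (map g xs)) *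
        cnj (of_real (flip T (prod_list ys)) * prod_list (map g ys)))"
      unfolding zk cnj_sum sum_product by (rule sum.cartesian_product)
    also have "\<dots> = (\<Sum>(xs, ys)\<in>L \<times> L. of_real (flip T (prod_list (xs @ ys))) * G xs ys)"
    proof (intro sum.cong refl, clarify)
      fix xs ys assume "xs \<in> L" "ys \<in> L"
      then have "prod_list xs > 0" "prod_list ys > 0"
        by (auto simp: L_def intro!: Nat.gr0I simp: prod_list_zero_iff)
      then show "(of_real (flip T (prod_list xs)) * prod_list (map g xs)) *
        cnj (of_real (flip T (prod_list ys)) * prod_list (map g ys)) = of_real (flip T (prod_list (xs @ ys))) * G xs ys"
        by (simp add: G_def flip_mult[OF TP])
    qed
    finally show ?thesis unfolding z_def .
  qed
  \<comment> \<open>A concatenation determines both lists since each has length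
    \<open>k\<close>.\<close>
  have card_le: "card {(xs, ys)\<in>L \<times> L. xs @ ys \<in> square_lists N (2 * k)} \<le> card (square_lists N (2 * k))"
    by (rule card_inj_on_le[of "\<lambda>(xs, ys). xs @ ys"]) (auto simp: inj_on_def L_def)
  have "complex_of_real (\<Sum>T\<in>Pow I. norm (\<Sum>n=1..N. of_real (flip T n) * g n) ^ (2 * k))
     = (\<Sum>T\<in>Pow I. \<Sum>(xs, ys)\<in>L \<times> L. of_real (flip T (prod_list (xs @ ys))) * G xs ys)"
    unfolding of_real_sum by (intro sum.cong refl expand)
  also have "\<dots> = (\<Sum>(xs, ys)\<in>L \<times> L. of_real (\<Sum>T\<in>Pow I. flip T (prod_list (xs @ ys))) * G xs ys)"
    by (subst sum.swap) (simp add: case_prod_unfold sum_distrib_right)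
  finally have "norm (complex_of_real (\<Sum>T\<in>Pow I. norm (\<Sum>n=1..N. of_real (flip T n) * g n) ^ (2 * k)))
     = norm (\<Sum>(xs, ys)\<in>L \<times> L. of_real (\<Sum>T\<in>Pow I. flip T (prod_list (xs @ ys))) * G xs ys)" by simp
  also have "\<dots> \<le> (\<Sum>(xs, ys)\<in>L \<times> L. if xs @ ys \<in> square_lists N (2 * k) then 2 ^ card I else 0)"
  proof (rule sum_norm_le, clarify)
    fix xs ys assume xy: "xs \<in> L" "ys \<in> L"
    let ?n = "prod_list (xs @ ys)"
    have "\<bar>\<Sum>T\<in>Pow I. flip T ?n\<bar> \<le> (if xs @ ys \<in> square_lists N (2 * k) then 2 ^ card I else 0)"
    proof (cases "xs @ ys \<in> square_lists N (2 * k)")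
      case True
      have "\<bar>\<Sum>T\<in>Pow I. flip T ?n\<bar> \<le> (\<Sum>T\<in>Pow I. \<bar>flip T ?n\<bar>)" by (rule sum_abs)
      then show ?thesis using True finI by (simp add: card_Pow)
    next
      case False
      have sub: "set (xs @ ys) \<subseteq> {1..N}" using xy by (auto simp: L_def)
      have "prime_factors (prod_list zs) \<subseteq> I" if "set zs \<subseteq> {1..N}" for zs
        using that
      proof (induction zs)
        case (Cons z zs)
        then have "prod_list zs \<noteq> 0" by (auto simp: prod_list_zero_iff)
        moreover have "prime_factors z \<subseteq> I"
          using Cons.prems by (auto simp: I_def in_prime_factors_iff dest!: dvd_imp_le)
        ultimately show ?case using Cons by (simp add: prime_factors_product)
      qed simp
      moreover have "?n > 0" using sub by (intro Nat.gr0I) (force simp: prod_list_zero_iff)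
      moreover have "\<nexists>c. ?n = c ^ 2"
        using False sub xy by (auto simp: square_lists_def L_def)
      ultimately show ?thesis using sum_flip_eq_0[OF finI, of ?n] sub False by (simp del: prod_list.append)
    qed
    then show "norm (of_real (\<Sum>T\<in>Pow I. flip T ?n) * G xs ys)
        \<le> (if xs @ ys \<in> square_lists N (2 * k) then 2 ^ card I else 0)"
      using mult_mono[OF _ G[OF xy], of "\<bar>\<Sum>T\<in>Pow I. flip T ?n\<bar>" "if xs @ ys \<in> square_lists N (2 * k) then 2 ^ card I else 0"]
      unfolding norm_mult norm_of_real by (simp del: prod_list.append)
  qed
  also have "\<dots> = 2 ^ card I * real (card {(xs, ys)\<in>L \<times> L. xs @ ys \<in> square_lists N (2 * k)})"
    using finL by (simp add: case_prod_unfold sum.inter_filter [symmetric] mem_Times_iff conj_assoc)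
  also have "\<dots> \<le> 2 ^ card I * real (card (square_lists N (2 * k)))"
    using card_le by simp
  finally show ?thesis
    unfolding norm_of_real by (subst (asm) abs_of_nonneg) (auto intro: sum_nonneg)
qed

section \<open>Riesz products over random signs\<close>

text \<open>The gain \<open>x^2 / 4\<close> is what makes a Riesz product small when its linear form
  is small. For \<open>x \<ge> 0\<close> the quadratic Taylor bound of \<open>exp\<close> applies to
  the exponent itself. For \<open>x < 0\<close> put \<open>s = - x + x^2 / 4\<close>; then
  \<open>1 + x \<le> (1 - s / 2)^2 \<le> exp (- s)\<close>, the first because
  \<open>s^2 \<ge> x^2\<close>.\<close>

lemma one_plus_le_exp_quadratic:
  fixes x :: real
  assumes "\<bar>x\<bar> \<le> 1 / 2"
  shows "1 + x \<le> exp (x - x\<^sup>2 / 4)"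
proof (cases "x \<ge> 0")
  case True
  define y where "y = x - x\<^sup>2 / 4"
  have y: "y = x * (1 - x / 4)" by (simp add: y_def power2_eq_square algebra_simps)
  then have "y \<ge> 0" using True assms by simp
  then have "1 + y + y\<^sup>2 / 2 \<le> exp y" by (rule exp_lower_Taylor_quadratic)
  moreover have "x\<^sup>2 / 2 \<le> y\<^sup>2"
  proof -
    have "(7/8)\<^sup>2 \<le> (1 - x / 4)\<^sup>2" using assms True by (intro power_mono) auto
    then have "1 / 2 \<le> (1 - x / 4)\<^sup>2" by (simp add: power2_eq_square)
    then have "x\<^sup>2 * (1 / 2) \<le> x\<^sup>2 * (1 - x / 4)\<^sup>2" by (intro mult_left_mono) auto
    then show ?thesis by (simp add: y power_mult_distrib)
  qed
  ultimately show ?thesis by (simp add: y_def)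
next
  case False
  define s where "s = - x + x\<^sup>2 / 4"
  have sx: "s \<ge> - x" by (simp add: s_def)
  have "x\<^sup>2 \<le> (1 / 2)\<^sup>2" using assms by (intro abs_le_square_iff [THEN iffD1]) auto
  then have s1: "s \<le> 1" using assms by (simp add: s_def power2_eq_square)
  have "x\<^sup>2 \<le> s\<^sup>2" using False sx by (intro abs_le_square_iff [THEN iffD1]) auto
  then have "1 + x \<le> (1 - s / 2)\<^sup>2" by (simp add: s_def power2_eq_square algebra_simps)
  also have "\<dots> \<le> (exp (- s / 2))\<^sup>2"
    using s1 exp_ge_add_one_self[of "- s / 2"] by (intro power_mono) auto
  also have "\<dots> = exp (x - x\<^sup>2 / 4)"
    by (simp add: power2_eq_square exp_add [symmetric] s_def)
  finally show ?thesis .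
qed

lemma sum_Pow_prod_if:
  fixes f g :: "'p \<Rightarrow> 'c::comm_semiring_1"
  assumes "finite P"
  shows "(\<Sum>T\<in>Pow P. \<Prod>p\<in>P. if p \<in> T then f p else g p) = (\<Prod>p\<in>P. f p + g p)"
  unfolding prod_add[OF assms]
proof (rule sum.cong [OF refl])
  fix T assume "T \<in> Pow P"
  then have "{p\<in>P. p \<in> T} = T" "{p\<in>P. p \<notin> T} = P - T" by auto
  then show "(\<Prod>p\<in>P. if p \<in> T then f p else g p) = prod f T * prod g (P - T)"
    using assms by (simp add: prod.If_cases Int_def Collect_neg_eq [symmetric])
qed

text \<open>A pattern of signs is encoded by its set \<open>T\<close> of minus signs, so averages
  over \<open>Pow P\<close> are expectations over independent uniform signs.\<close>

definition flip_sign :: "'p set \<Rightarrow> 'p \<Rightarrow> real" where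
  "flip_sign T p = (if p \<in> T then - 1 else 1)"

lemma sum_prod_flip_sign:
  assumes "finite P"
  shows "(\<Sum>T\<in>Pow P. \<Prod>p\<in>P. 1 + flip_sign T p * u p) = 2 ^ card P"
proof -
  have "1 + flip_sign T p * u p = (if p \<in> T then 1 - u p else 1 + u p)" for T p
    by (simp add: flip_sign_def)
  then show ?thesis by (simp add: sum_Pow_prod_if[OF assms])
qed

text \<open>The terms linear in a sign cancel:
  \<open>(1 - u) * (1 - v) + (1 + u) * (1 + v) = 2 * (1 + u * v)\<close>.\<close>

lemma sum_prod_flip_sign_mult:
  assumes "finite P"
  shows "(\<Sum>T\<in>Pow P. (\<Prod>p\<in>P. 1 + flip_sign T p * u p) * (\<Prod>p\<in>P. 1 + flip_sign T p * v p))
    = 2 ^ card P * (\<Prod>p\<in>P. 1 + u p * v p)"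
proof -
  have "(1 + flip_sign T p * u p) * (1 + flip_sign T p * v p)
      = (if p \<in> T then (1 - u p) * (1 - v p) else (1 + u p) * (1 + v p))" for T p
    by (simp add: flip_sign_def)
  then have "(\<Sum>T\<in>Pow P. (\<Prod>p\<in>P. 1 + flip_sign T p * u p) * (\<Prod>p\<in>P. 1 + flip_sign T p * v p))
      = (\<Prod>p\<in>P. (1 - u p) * (1 - v p) + (1 + u p) * (1 + v p))"
    by (simp add: prod.distrib [symmetric] sum_Pow_prod_if[OF assms])
  also have "\<dots> = (\<Prod>p\<in>P. 2 * (1 + u p * v p))"
    by (intro prod.cong refl) (simp add: algebra_simps)
  also have "\<dots> = 2 ^ card P * (\<Prod>p\<in>P. 1 + u p * v p)"
    by (simp only: prod.distrib prod_constant)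
  finally show ?thesis .
qed

text \<open>Combine \<open>exp x \<le> 1 + x * exp x\<close> with
  \<open>\<bar>x\<bar> \<le> \<mu> + x^2 / \<mu>\<close>. The excess over 1 is expressed by
  \<open>x^2\<close>, so that a mean square bound on correlations suffices; \<open>\<mu>\<close> is
  left free for a later choice.\<close>

lemma exp_minus_one_le:
  fixes x t \<mu> :: real
  assumes "x \<le> t" "t \<ge> 0" "\<mu> > 0"
  shows "exp x \<le> 1 + exp t * (\<mu> + x\<^sup>2 / \<mu>)"
proof -
  have "1 + (- x) \<le> exp (- x)" by (rule exp_ge_add_one_self)
  then have "exp x * (1 - x) \<le> exp x * exp (- x)" by (intro mult_left_mono) auto
  then have "exp x \<le> 1 + x * exp x" by (simp add: exp_minus algebra_simps)
  also have "x * exp x \<le> \<bar>x\<bar> * exp t" using assms by (intro mult_mono) auto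
  also have "\<bar>x\<bar> \<le> \<mu> + x\<^sup>2 / \<mu>"
  proof (cases "\<bar>x\<bar> \<le> \<mu>")
    case True
    moreover have "x\<^sup>2 / \<mu> \<ge> 0" using assms by simp
    ultimately show ?thesis by linarith
  next
    case False
    then have "\<bar>x\<bar> * \<mu> \<le> \<bar>x\<bar> * \<bar>x\<bar>" by (intro mult_left_mono) auto
    then have "\<bar>x\<bar> \<le> x\<^sup>2 / \<mu>" using assms by (simp add: field_simps power2_eq_square)
    then show ?thesis using assms by simp
  qed
  then have "\<bar>x\<bar> * exp t \<le> (\<mu> + x\<^sup>2 / \<mu>) * exp t" by (intro mult_right_mono) auto
  finally show ?thesis by (simp add: mult.commute)
qed

text \<open>Second moment method for \<open>Z T\<close>, the average over \<open>S\<close> of the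
  Riesz products \<open>w T a\<close>. Its mean over \<open>T\<close> is 1, and by the correlation
  hypothesis its variance is at most \<open>\<eta>\<close>. If all linear forms lie below the
  threshold, every Riesz product is at most \<open>exp (- 1)\<close>, so
  \<open>Z T \<le> 1 / 2\<close>; Chebyshev's inequality at distance \<open>1 / 2\<close> gives the
  factor 4.\<close>

lemma card_signs_small_max_le:
  fixes g :: "'p \<Rightarrow> 'i \<Rightarrow> real"
  assumes fin: "finite P" "finite S" "S \<noteq> {}"
  assumes l: "l > 0" and mu: "\<mu> > 0"
  assumes small: "\<And>p a. p \<in> P \<Longrightarrow> a \<in> S \<Longrightarrow> \<bar>l * g p a\<bar> \<le> 1 / 2"
  assumes D: "\<And>a. a \<in> S \<Longrightarrow> V / 4 \<le> (\<Sum>p\<in>P. (g p a)\<^sup>2)" "\<And>a. a \<in> S \<Longrightarrow> (\<Sum>p\<in>P. (g p a)\<^sup>2) \<le> V"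
  assumes C: "(\<Sum>a\<in>S. \<Sum>b\<in>S. (\<Sum>p\<in>P. g p a * g p b)\<^sup>2) \<le> (real (card S))\<^sup>2 * \<kappa>"
  shows "real (card {T\<in>Pow P. \<forall>a\<in>S. (\<Sum>p\<in>P. flip_sign T p * g p a) < l * V / 16 - 1 / l})
    \<le> 2 ^ card P * (4 * (exp (l\<^sup>2 * V) * (\<mu> + l ^ 4 * \<kappa> / \<mu>)))"
proof -
  define w where "w = (\<lambda>T a. \<Prod>p\<in>P. 1 + flip_sign T p * (l * g p a))"
  define Z where "Z = (\<lambda>T. (\<Sum>a\<in>S. w T a) / real (card S))"
  define \<eta> where "\<eta> = exp (l\<^sup>2 * V) * (\<mu> + l ^ 4 * \<kappa> / \<mu>)"
  let ?B = "{T\<in>Pow P. \<forall>a\<in>S. (\<Sum>p\<in>P. flip_sign T p * g p a) < l * V / 16 - 1 / l}"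
  have cS: "real (card S) > 0" using fin by (simp add: card_gt_0_iff)
  obtain a0 where "a0 \<in> S" using fin by auto
  have V0: "V \<ge> 0" using D(2)[OF \<open>a0 \<in> S\<close>] sum_nonneg[of P "\<lambda>p. (g p a0)\<^sup>2"] by simp
  have EZ: "(\<Sum>T\<in>Pow P. Z T) = 2 ^ card P"
  proof -
    have "(\<Sum>T\<in>Pow P. Z T) = (\<Sum>a\<in>S. \<Sum>T\<in>Pow P. w T a) / real (card S)"
      unfolding Z_def sum_divide_distrib [symmetric] by (subst sum.swap) simp
    also have "\<dots> = 2 ^ card P"
      unfolding w_def sum_prod_flip_sign[OF fin(1)] using cS by simp
    finally show ?thesis .
  qed
  have pair: "(\<Prod>p\<in>P. 1 + l * g p a * (l * g p b)) \<le> 1 + exp (l\<^sup>2 * V) * (\<mu> + l ^ 4 * (\<Sum>p\<in>P. g p a * g p b)\<^sup>2 / \<mu>)"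
    if ab: "a \<in> S" "b \<in> S" for a b
  proof -
    let ?C = "\<Sum>p\<in>P. g p a * g p b"
    have "(\<Prod>p\<in>P. 1 + l * g p a * (l * g p b)) \<le> (\<Prod>p\<in>P. exp (l * g p a * (l * g p b)))"
    proof (rule prod_mono, safe)
      fix p assume p: "p \<in> P"
      have "\<bar>l * g p a * (l * g p b)\<bar> \<le> 1/2 * (1/2)"
        unfolding abs_mult[of "l * g p a"] using small[OF p] ab by (intro mult_mono) auto
      then show "0 \<le> 1 + l * g p a * (l * g p b)" by linarith
    qed (rule exp_ge_add_one_self)
    also have "\<dots> = exp (l\<^sup>2 * ?C)"
      by (simp add: exp_sum[OF fin(1), symmetric] sum_distrib_left power2_eq_square algebra_simps)
    also have "\<dots> \<le> 1 + exp (l\<^sup>2 * V) * (\<mu> + (l\<^sup>2 * ?C)\<^sup>2 / \<mu>)"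
    proof (rule exp_minus_one_le)
      \<comment> \<open>By the arithmetic-geometric mean inequality no correlation exceeds
        \<open>V\<close>, which caps the exponential uniformly; the mean square of the correlations
        is used only through the quadratic term.\<close>
      have "?C \<le> (\<Sum>p\<in>P. ((g p a)\<^sup>2 + (g p b)\<^sup>2) / 2)"
      proof (rule sum_mono)
        fix p show "g p a * g p b \<le> ((g p a)\<^sup>2 + (g p b)\<^sup>2) / 2"
          using sum_squares_bound[of "g p a" "g p b"] by simp
      qed
      also have "\<dots> = ((\<Sum>p\<in>P. (g p a)\<^sup>2) + (\<Sum>p\<in>P. (g p b)\<^sup>2)) / 2"
        by (simp add: sum.distrib sum_divide_distrib [symmetric])
      also have "\<dots> \<le> V" using D(2)[OF ab(1)] D(2)[OF ab(2)] by simp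
      finally show "l\<^sup>2 * ?C \<le> l\<^sup>2 * V" by (intro mult_left_mono) auto
    qed (use mu V0 in auto)
    finally show ?thesis by (simp add: power_mult_distrib)
  qed
  have EZ2: "(\<Sum>T\<in>Pow P. (Z T)\<^sup>2) \<le> 2 ^ card P * (1 + \<eta>)"
  proof -
    have "(\<Sum>T\<in>Pow P. (Z T)\<^sup>2) = (\<Sum>T\<in>Pow P. \<Sum>a\<in>S. \<Sum>b\<in>S. w T a * w T b) / (real (card S))\<^sup>2"
      by (simp add: Z_def power_divide power2_eq_square sum_product sum_divide_distrib)
    also have "(\<Sum>T\<in>Pow P. \<Sum>a\<in>S. \<Sum>b\<in>S. w T a * w T b) = (\<Sum>a\<in>S. \<Sum>T\<in>Pow P. \<Sum>b\<in>S. w T a * w T b)"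
      by (rule sum.swap)
    also have "\<dots> = (\<Sum>a\<in>S. \<Sum>b\<in>S. \<Sum>T\<in>Pow P. w T a * w T b)"
      by (intro sum.cong refl sum.swap)
    also have "\<dots> = (\<Sum>a\<in>S. \<Sum>b\<in>S. 2 ^ card P * (\<Prod>p\<in>P. 1 + l * g p a * (l * g p b)))"
      unfolding w_def sum_prod_flip_sign_mult[OF fin(1)] ..
    also have "\<dots> \<le> (\<Sum>a\<in>S. \<Sum>b\<in>S. 2 ^ card P * (1 + exp (l\<^sup>2 * V) * (\<mu> + l ^ 4 * (\<Sum>p\<in>P. g p a * g p b)\<^sup>2 / \<mu>)))"
      by (intro sum_mono mult_left_mono pair) auto
    also have "\<dots> = 2 ^ card P * ((real (card S))\<^sup>2 * (1 + exp (l\<^sup>2 * V) * \<mu>)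
        + exp (l\<^sup>2 * V) * l ^ 4 / \<mu> * (\<Sum>a\<in>S. \<Sum>b\<in>S. (\<Sum>p\<in>P. g p a * g p b)\<^sup>2))"
    proof -
      have "(\<Sum>a\<in>S. \<Sum>b\<in>S. k * (1 + E * (\<mu> + L * c a b / \<mu>)))
          = k * ((real (card S))\<^sup>2 * (1 + E * \<mu>) + E * L / \<mu> * (\<Sum>a\<in>S. \<Sum>b\<in>S. c a b))"
        for k E L :: real and c :: "'i \<Rightarrow> 'i \<Rightarrow> real"
        by (simp add: sum.distrib sum_distrib_left sum_divide_distrib power2_eq_square algebra_simps)
      then show ?thesis .
    qed
    also have "\<dots> \<le> 2 ^ card P * ((real (card S))\<^sup>2 * (1 + exp (l\<^sup>2 * V) * \<mu>)
        + exp (l\<^sup>2 * V) * l ^ 4 / \<mu> * ((real (card S))\<^sup>2 * \<kappa>))"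
      using mu C by (intro mult_left_mono add_left_mono) auto
    also have "\<dots> = (2 ^ card P * (1 + \<eta>)) * (real (card S))\<^sup>2"
      by (simp add: \<eta>_def algebra_simps)
    finally show ?thesis using cS by (simp add: divide_le_eq)
  qed
  have var: "(\<Sum>T\<in>Pow P. (Z T - 1)\<^sup>2) \<le> 2 ^ card P * \<eta>"
  proof -
    have "(\<Sum>T\<in>Pow P. (Z T - 1)\<^sup>2) = (\<Sum>T\<in>Pow P. (Z T)\<^sup>2) - 2 * (\<Sum>T\<in>Pow P. Z T) + 2 ^ card P"
      using fin by (simp add: power2_diff sum.distrib sum_subtractf sum_distrib_left card_Pow)
    then show ?thesis using EZ EZ2 by (simp add: algebra_simps)
  qed
  have bad: "1 / 4 \<le> (Z T - 1)\<^sup>2" if T: "T \<in> ?B" for T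
  proof -
    have "w T a \<le> 1 / 2" if a: "a \<in> S" for a
    proof -
      let ?x = "\<lambda>p. flip_sign T p * (l * g p a)"
      have absx: "\<bar>?x p\<bar> \<le> 1 / 2" if "p \<in> P" for p
        using small[OF that a] by (auto simp: flip_sign_def)
      have "w T a \<le> (\<Prod>p\<in>P. exp (?x p - (?x p)\<^sup>2 / 4))"
        unfolding w_def
      proof (rule prod_mono, safe)
        fix p assume "p \<in> P"
        then show "0 \<le> 1 + ?x p" "1 + ?x p \<le> exp (?x p - (?x p)\<^sup>2 / 4)"
          using absx[of p] one_plus_le_exp_quadratic[of "?x p"] by (auto simp: abs_le_iff)
      qed
      also have "\<dots> = exp (\<Sum>p\<in>P. ?x p - (?x p)\<^sup>2 / 4)" by (rule exp_sum[OF fin(1), symmetric])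
      also have "(\<Sum>p\<in>P. ?x p - (?x p)\<^sup>2 / 4) = l * (\<Sum>p\<in>P. flip_sign T p * g p a) - l\<^sup>2 * (\<Sum>p\<in>P. (g p a)\<^sup>2) / 4"
      proof -
        have "(?x p)\<^sup>2 = l\<^sup>2 * (g p a)\<^sup>2" for p by (simp add: flip_sign_def power_mult_distrib)
        then show ?thesis by (simp add: sum_subtractf sum_distrib_left sum_divide_distrib mult_ac)
      qed
      \<comment> \<open>The threshold is chosen so that \<open>l^2 * V / 16\<close> cancels and
        exactly \<open>- 1\<close> remains.\<close>
      also have "\<dots> \<le> l * (l * V / 16 - 1 / l) - l\<^sup>2 * (V / 4) / 4"
        using T a l D(1)[OF a] by (intro diff_mono mult_left_mono divide_right_mono) (auto intro: less_imp_le)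
      also have "\<dots> = - 1" using l by (simp add: algebra_simps power2_eq_square)
      finally have "w T a \<le> exp (- 1)" by simp
      also have "\<dots> \<le> 1 / 2"
        using exp_ge_add_one_self[of 1] by (simp add: exp_minus field_simps)
      finally show ?thesis .
    qed
    then have "(\<Sum>a\<in>S. w T a) \<le> real (card S) * (1 / 2)"
      using sum_bounded_above[of S "w T" "1/2"] by simp
    then have "Z T \<le> 1 / 2" unfolding Z_def using cS by (simp add: field_simps)
    then have "(1 / 2)\<^sup>2 \<le> (1 - Z T)\<^sup>2" by (intro power_mono) auto
    then show ?thesis by (simp add: power2_eq_square algebra_simps)
  qed
  have finB: "finite ?B" using fin by simp
  have "real (card ?B) * (1 / 4) = (\<Sum>T\<in>?B. 1 / 4)" by simp
  also have "\<dots> \<le> (\<Sum>T\<in>?B. (Z T - 1)\<^sup>2)" by (intro sum_mono bad)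
  also have "\<dots> \<le> (\<Sum>T\<in>Pow P. (Z T - 1)\<^sup>2)" using fin by (intro sum_mono2) auto
  also have "\<dots> \<le> 2 ^ card P * \<eta>" by (rule var)
  finally show ?thesis unfolding \<eta>_def by (simp add: algebra_simps)
qed

section \<open>Sign flips at the large primes\<close>

lemma e2pi_add: "e2pi (x + y) = e2pi x * e2pi y"
  by (simp add: e2pi_def exp_add [symmetric] algebra_simps)

lemma e2pi_eq_cis: "e2pi x = cis (2 * pi * x)"
  by (simp add: e2pi_def cis_conv_exp mult_ac)

lemma norm_e2pi [simp]: "norm (e2pi x) = 1"
  by (simp add: e2pi_eq_cis)

lemma cnj_e2pi: "cnj (e2pi x) = e2pi (- x)"
  by (simp add: e2pi_eq_cis cis_cnj)

lemma e2pi_power: "e2pi x ^ n = e2pi (real n * x)"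
  by (induction n) (simp_all add: e2pi_add ring_distribs, simp add: e2pi_def)

lemma e2pi_of_int [simp]: "e2pi (of_int k) = 1"
  using cis_multiple_2pi[of "of_int k"] by (simp add: e2pi_eq_cis)

lemma e2pi_eq_1D:
  assumes "e2pi x = 1"
  obtains k :: int where "x = of_int k"
proof -
  obtain k :: int where "2 * pi * x = of_int (2 * k) * pi"
    using assms unfolding e2pi_def exp_eq_1 by auto
  then have "x = of_int k" by simp
  then show ?thesis using that by blast
qed

definition grid_char :: "nat \<Rightarrow> int \<Rightarrow> nat \<Rightarrow> complex" where
  "grid_char Q k a = e2pi (of_int k * (real a / real Q))"

lemma grid_char_add: "grid_char Q (k + l) a = grid_char Q k a * grid_char Q l a"
  by (simp add: grid_char_def e2pi_add [symmetric] ring_distribs add_divide_distrib)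

lemma cnj_grid_char: "cnj (grid_char Q k a) = grid_char Q (- k) a"
  by (simp add: grid_char_def cnj_e2pi)

lemma norm_grid_char [simp]: "norm (grid_char Q k a) = 1"
  by (simp add: grid_char_def)

lemma grid_char_0 [simp]: "grid_char Q 0 a = 1"
  using e2pi_of_int[of 0] by (simp add: grid_char_def)

text \<open>Orthogonality of characters: a full geometric sum whose ratio is a nontrivial
  \<open>Q\<close>-th root of unity.\<close>

lemma sum_grid_char:
  assumes "Q > 0" "\<not> int Q dvd k"
  shows "(\<Sum>a<Q. grid_char Q k a) = 0"
proof -
  define z where "z = e2pi (of_int k / real Q)"
  have "z \<noteq> 1"
  proof
    assume "z = 1"
    then obtain m :: int where "of_int k / real Q = of_int m" unfolding z_def by (rule e2pi_eq_1D)
    then have "of_int k = (of_int (m * int Q) :: real)" using assms(1) by (simp add: field_simps)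
    then have "k = m * int Q" by (simp only: of_int_eq_iff)
    then show False using assms(2) by simp
  qed
  have "(\<Sum>a<Q. grid_char Q k a) = (\<Sum>a<Q. z ^ a)"
    by (intro sum.cong refl) (simp add: grid_char_def z_def e2pi_power mult_ac)
  also have "\<dots> = (z ^ Q - 1) / (z - 1)" by (rule geometric_sum) fact
  also have "z ^ Q = 1" using assms(1) by (simp add: z_def e2pi_power)
  finally show ?thesis by simp
qed

text \<open>After expansion every frequency \<open>u i + v j\<close> is nonzero modulo
  \<open>Q\<close>, so each term sums to 0 over the grid.\<close>

lemma sum_grid_char_mult_eq_0:
  assumes "Q > 0" "\<And>i j. i \<in> I \<Longrightarrow> j \<in> J \<Longrightarrow> \<not> int Q dvd u i + v j"
  shows "(\<Sum>a<Q. (\<Sum>i\<in>I. c i * grid_char Q (u i) a) * (\<Sum>j\<in>J. d j * grid_char Q (v j) a)) = 0"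
proof -
  have "(\<Sum>a<Q. (\<Sum>i\<in>I. c i * grid_char Q (u i) a) * (\<Sum>j\<in>J. d j * grid_char Q (v j) a))
      = (\<Sum>a<Q. \<Sum>i\<in>I. \<Sum>j\<in>J. c i * d j * grid_char Q (u i + v j) a)"
    unfolding sum_product grid_char_add by (simp add: mult_ac)
  also have "\<dots> = (\<Sum>i\<in>I. \<Sum>a<Q. \<Sum>j\<in>J. c i * d j * grid_char Q (u i + v j) a)"
    by (rule sum.swap)
  also have "\<dots> = (\<Sum>i\<in>I. \<Sum>j\<in>J. \<Sum>a<Q. c i * d j * grid_char Q (u i + v j) a)"
    by (intro sum.cong refl sum.swap)
  also have "\<dots> = 0"
  proof (rule sum.neutral, rule ballI, rule sum.neutral, rule ballI)
    fix i j assume "i \<in> I" "j \<in> J"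
    then show "(\<Sum>a<Q. c i * d j * grid_char Q (u i + v j) a) = 0"
      using assms by (simp add: sum_distrib_left [symmetric] sum_grid_char)
  qed
  finally show ?thesis .
qed

text \<open>Parseval's identity on the grid: the frequencies in \<open>R\<close> are distinct modulo
  \<open>Q\<close>, so only the diagonal survives.\<close>

lemma sum_norm_sq_grid_poly:
  assumes "finite R" "Q > 0" "\<And>m n. m \<in> R \<Longrightarrow> n \<in> R \<Longrightarrow> m \<noteq> n \<Longrightarrow> \<not> int Q dvd int m - int n"
  shows "(\<Sum>a<Q. (norm (\<Sum>n\<in>R. c n * grid_char Q (int n) a))\<^sup>2) = real Q * (\<Sum>n\<in>R. (norm (c n))\<^sup>2)"
proof -
  have "complex_of_real (\<Sum>a<Q. (norm (\<Sum>n\<in>R. c n * grid_char Q (int n) a))\<^sup>2)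
      = (\<Sum>a<Q. \<Sum>m\<in>R. \<Sum>n\<in>R. c m * cnj (c n) * grid_char Q (int m - int n) a)"
    unfolding of_real_sum complex_norm_square cnj_sum sum_product
    by (simp add: cnj_grid_char grid_char_add [symmetric] mult_ac)
  also have "\<dots> = (\<Sum>m\<in>R. \<Sum>a<Q. \<Sum>n\<in>R. c m * cnj (c n) * grid_char Q (int m - int n) a)"
    by (rule sum.swap)
  also have "\<dots> = (\<Sum>m\<in>R. \<Sum>n\<in>R. \<Sum>a<Q. c m * cnj (c n) * grid_char Q (int m - int n) a)"
    by (intro sum.cong refl sum.swap)
  also have "\<dots> = (\<Sum>m\<in>R. \<Sum>n\<in>R. if m = n then of_nat Q * (c n * cnj (c n)) else 0)"
    using assms(2,3) by (intro sum.cong refl) (auto simp: sum_distrib_left [symmetric] sum_grid_char)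
  also have "\<dots> = (\<Sum>m\<in>R. of_nat Q * (c m * cnj (c m)))"
    using assms(1) by simp
  also have "\<dots> = of_real (real Q * (\<Sum>n\<in>R. (norm (c n))\<^sup>2))"
    by (simp add: sum_distrib_left complex_norm_square [symmetric])
  finally show ?thesis by (simp only: of_real_eq_iff)
qed

section \<open>Fourier expansion of real parts and of their centred squares\<close>

definition freqs :: "nat \<Rightarrow> int set" where
  "freqs n = int ` {1..n} \<union> (\<lambda>j. - int j) ` {1..n}"

text \<open>Fourier coefficients of a real part, from \<open>Re z = z / 2 + cnj z / 2\<close>:
  conjugation moves the frequencies to the negative side.\<close>

definition real_coeff :: "(nat \<Rightarrow> complex) \<Rightarrow> int \<Rightarrow> complex" where
  "real_coeff w k = (if k > 0 then w (nat k) / 2 else cnj (w (nat (- k))) / 2)"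

lemma finite_freqs [simp]: "finite (freqs n)" by (simp add: freqs_def)

lemma freqsD: "k \<in> freqs n \<Longrightarrow> k \<noteq> 0 \<and> \<bar>k\<bar> \<le> int n" by (auto simp: freqs_def)

lemma sum_freqs: "(\<Sum>k\<in>freqs n. F k) = (\<Sum>j=1..n. F (int j)) + (\<Sum>j=1..n. F (- int j))"
  unfolding freqs_def by (subst sum.union_disjoint) (auto simp: sum.reindex inj_on_def)

lemma Re_grid_poly:
  "complex_of_real (Re (\<Sum>j=1..n. w j * grid_char Q (int j * p) a))
    = (\<Sum>k\<in>freqs n. real_coeff w k * grid_char Q (k * p) a)"
proof -
  define z where "z = (\<Sum>j=1..n. w j * grid_char Q (int j * p) a)"
  have "complex_of_real (Re z) = z / 2 + cnj z / 2" by (simp add: complex_eq_iff)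
  also have "z / 2 = (\<Sum>j=1..n. real_coeff w (int j) * grid_char Q (int j * p) a)"
    unfolding z_def sum_divide_distrib by (intro sum.cong) (auto simp: real_coeff_def)
  also have "cnj z / 2 = (\<Sum>j=1..n. real_coeff w (- int j) * grid_char Q (- int j * p) a)"
    unfolding z_def sum_divide_distrib cnj_sum by (intro sum.cong) (auto simp: real_coeff_def cnj_grid_char)
  finally show ?thesis unfolding z_def sum_freqs .
qed

text \<open>In the square, the pairs of opposite frequencies \<open>(k, - k)\<close> form the
  constant term. There are \<open>2 * n\<close> of them, each with coefficient \<open>1 / 4\<close>
  because \<open>w\<close> is unimodular, which gives \<open>n / 2\<close>; subtracting it leaves
  only pairs with nonzero sum.\<close>

lemma Re_grid_poly_sq:
  assumes "\<And>j. j \<in> {1..n} \<Longrightarrow> norm (w j) = 1"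
  shows "complex_of_real ((Re (\<Sum>j=1..n. w j * grid_char Q (int j * p) a))\<^sup>2 - real n / 2)
    = (\<Sum>x\<in>{x\<in>freqs n \<times> freqs n. fst x + snd x \<noteq> 0}.
        (real_coeff w (fst x) * real_coeff w (snd x)) * grid_char Q ((fst x + snd x) * p) a)"
proof -
  let ?c = "real_coeff w"
  let ?F = "\<lambda>x. (?c (fst x) * ?c (snd x)) * grid_char Q ((fst x + snd x) * p) a"
  let ?X = "freqs n \<times> freqs n"
  have cc: "?c k * ?c (- k) = 1 / 4" if "k \<in> freqs n" for k
  proof -
    have "w j * cnj (w j) = 1" if "j \<in> {1..n}" for j
      using assms[OF that] by (simp add: complex_norm_square [symmetric])
    then show ?thesis using that by (auto simp: freqs_def real_coeff_def mult.commute)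
  qed
  have "complex_of_real ((Re (\<Sum>j=1..n. w j * grid_char Q (int j * p) a))\<^sup>2)
     = (\<Sum>k\<in>freqs n. ?c k * grid_char Q (k * p) a) * (\<Sum>k\<in>freqs n. ?c k * grid_char Q (k * p) a)"
    unfolding power2_eq_square of_real_mult Re_grid_poly ..
  also have "\<dots> = (\<Sum>x\<in>?X. ?F x)"
    unfolding sum_product sum.cartesian_product
    by (intro sum.cong) (auto simp: ring_distribs grid_char_add)
  also have "\<dots> = (\<Sum>x\<in>{x\<in>?X. fst x + snd x \<noteq> 0}. ?F x) + (\<Sum>x\<in>{x\<in>?X. fst x + snd x = 0}. ?F x)"
    by (subst sum.union_disjoint [symmetric]) (auto intro!: sum.cong)
  also have "{x\<in>?X. fst x + snd x = 0} = (\<lambda>k. (k, - k)) ` freqs n"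
    by (auto simp: freqs_def image_iff)
  also have "(\<Sum>x\<in>\<dots>. ?F x) = (\<Sum>k\<in>freqs n. ?c k * ?c (- k))"
    by (subst sum.reindex) (auto simp: inj_on_def)
  also have "\<dots> = (\<Sum>k\<in>freqs n. 1 / 4)" by (intro sum.cong refl cc)
  also have "\<dots> = of_real (real n / 2)" by (simp only: sum_freqs) simp
  finally show ?thesis by simp
qed

section \<open>Size and divisibility of the large primes\<close>

lemma large_primes_div_less:
  assumes "N \<ge> 16" "p \<in> large_primes N"
  shows "(N div p) ^ 4 < N"
proof (cases "N div p = 0")
  case False
  let ?n = "N div p"
  have "(?n * p) ^ 4 \<le> N ^ 4" by (intro power_mono) auto
  then have "?n ^ 4 * p ^ 4 \<le> N * N ^ 3" by (simp add: power_mult_distrib power_Suc [symmetric] del: power_Suc)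
  moreover have "?n ^ 4 * N ^ 3 < ?n ^ 4 * p ^ 4"
    using assms False by (intro mult_strict_left_mono) (auto simp: large_primes_def)
  ultimately have "?n ^ 4 * N ^ 3 < N * N ^ 3" by linarith
  then show ?thesis by simp
qed (use assms in auto)

text \<open>Compare fourth powers: \<open>16 * (N div p) ^ 4 < 16 * N \<le> N ^ 3 < q ^ 4\<close>.
  The factor 2 provides for the doubled frequencies of squares.\<close>

lemma large_primes_two_div_less:
  assumes "N \<ge> 16" "p \<in> large_primes N" "q \<in> large_primes N"
  shows "2 * (N div p) < q"
proof -
  have "(2 * (N div p)) ^ 4 = 16 * (N div p) ^ 4" by (simp add: power_mult_distrib)
  also have "\<dots> < 16 * N" using large_primes_div_less[OF assms(1,2)] by simp
  also have "\<dots> \<le> N ^ 2 * N" using assms(1) by (intro mult_right_mono) (auto simp: power2_eq_square intro: le_trans[of 16 N])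
  also have "\<dots> = N ^ 3" by (simp add: power2_eq_square power3_eq_cube)
  also have "\<dots> < q ^ 4" using assms(3) by (simp add: large_primes_def)
  finally show ?thesis by (rule power_less_imp_less_base) simp
qed

text \<open>The combination has absolute value at most \<open>4 * N\<close>, below the modulus, so
  divisibility would force it to be 0. Then \<open>p\<close> divides \<open>l * q\<close>, hence
  \<open>l\<close>, but \<open>0 < \<bar>l\<bar> < p\<close>.\<close>

lemma large_primes_not_dvd:
  fixes k l :: int
  assumes N: "N \<ge> 16" and pq: "p \<in> large_primes N" "q \<in> large_primes N" "p \<noteq> q"
  assumes k: "\<bar>k\<bar> \<le> 2 * int (N div p)" and l: "l \<noteq> 0" "\<bar>l\<bar> \<le> 2 * int (N div q)"
  shows "\<not> int (8 * N + 1) dvd k * int p + l * int q"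
proof
  assume dvd: "int (8 * N + 1) dvd k * int p + l * int q"
  have "\<bar>k * int p\<bar> \<le> 2 * int (N div p) * int p"
    unfolding abs_mult using k by (intro mult_mono) auto
  also have "\<dots> \<le> 2 * int N" by (simp flip: of_nat_mult)
  finally have 1: "\<bar>k * int p\<bar> \<le> 2 * int N" .
  have "\<bar>l * int q\<bar> \<le> 2 * int (N div q) * int q"
    unfolding abs_mult using l by (intro mult_mono) auto
  also have "\<dots> \<le> 2 * int N" by (simp flip: of_nat_mult)
  finally have 2: "\<bar>l * int q\<bar> \<le> 2 * int N" .
  have "k * int p + l * int q = 0"
  proof (rule ccontr)
    assume "k * int p + l * int q \<noteq> 0"
    then have "\<bar>int (8 * N + 1)\<bar> \<le> \<bar>k * int p + l * int q\<bar>"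
      using dvd dvd_imp_le_int by blast
    then show False using 1 2 by linarith
  qed
  then have "int p dvd l * int q"
    by (metis add.inverse_unique dvd_minus_iff dvd_triv_right add.commute)
  moreover have "prime (int p)" "\<not> int p dvd int q"
    using pq by (auto simp: large_primes_def primes_dvd_imp_eq)
  ultimately have "int p dvd l" by (simp add: prime_dvd_mult_iff)
  then have "int p \<le> \<bar>l\<bar>" using l dvd_imp_le_int[of l "int p"] by simp
  moreover have "2 * int (N div q) < int p"
    using large_primes_two_div_less[OF N pq(2,1)] by linarith
  ultimately show False using l by linarith
qed

section \<open>Orthogonality of the contributions of different large primes\<close>

context
  fixes N Q :: nat and w :: "nat \<Rightarrow> nat \<Rightarrow> complex" and g :: "nat \<Rightarrow> nat \<Rightarrow> real"
  assumes N: "N \<ge> 16" and Q: "Q = 8 * N + 1"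
  assumes w: "\<And>p j. p \<in> large_primes N \<Longrightarrow> j \<in> {1..N div p} \<Longrightarrow> norm (w p j) = 1"
  defines "g \<equiv> \<lambda>p a. Re (\<Sum>j=1..N div p. w p j * grid_char Q (int j * int p) a)"
begin

lemma sum_large_prime_cross_eq_0:
  assumes "p \<in> large_primes N" "q \<in> large_primes N" "p \<noteq> q"
  shows "(\<Sum>a<Q. g p a * g q a) = 0"
proof -
  have "complex_of_real (\<Sum>a<Q. g p a * g q a) =
     (\<Sum>a<Q. (\<Sum>k\<in>freqs (N div p). real_coeff (w p) k * grid_char Q (k * int p) a) *
        (\<Sum>k\<in>freqs (N div q). real_coeff (w q) k * grid_char Q (k * int q) a))"
    unfolding of_real_sum of_real_mult g_def Re_grid_poly ..
  also have "\<dots> = 0"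
  proof (rule sum_grid_char_mult_eq_0)
    fix k l assume "k \<in> freqs (N div p)" "l \<in> freqs (N div q)"
    then show "\<not> int Q dvd k * int p + l * int q"
      unfolding Q by (intro large_primes_not_dvd N assms) (auto dest!: freqsD)
  qed (simp add: Q)
  finally show ?thesis by (simp only: of_real_eq_0_iff)
qed

text \<open>Centring removes the zero frequency. The remaining ones are nonzero multiples of the
  prime, by factors up to \<open>2 * (N div p)\<close>, which is the range covered by
  \<open>large_primes_not_dvd\<close>.\<close>

lemma sum_large_prime_sq_cross_eq_0:
  assumes "p \<in> large_primes N" "q \<in> large_primes N" "p \<noteq> q"
  shows "(\<Sum>a<Q. ((g p a)\<^sup>2 - real (N div p) / 2) * ((g q a)\<^sup>2 - real (N div q) / 2)) = 0"
proof -
  have rep: "complex_of_real ((g r a)\<^sup>2 - real (N div r) / 2)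
      = (\<Sum>x\<in>{x\<in>freqs (N div r) \<times> freqs (N div r). fst x + snd x \<noteq> 0}.
        (real_coeff (w r) (fst x) * real_coeff (w r) (snd x)) * grid_char Q ((fst x + snd x) * int r) a)"
    if "r \<in> large_primes N" for r a
    unfolding g_def by (rule Re_grid_poly_sq) (rule w[OF that])
  have "complex_of_real (\<Sum>a<Q. ((g p a)\<^sup>2 - real (N div p) / 2) * ((g q a)\<^sup>2 - real (N div q) / 2)) =
     (\<Sum>a<Q. complex_of_real ((g p a)\<^sup>2 - real (N div p) / 2) * complex_of_real ((g q a)\<^sup>2 - real (N div q) / 2))"
    unfolding of_real_sum of_real_mult ..
  also have "\<dots> = 0"
    unfolding rep[OF assms(1)] rep[OF assms(2)]
  proof (rule sum_grid_char_mult_eq_0)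
    fix x y assume "x \<in> {x \<in> freqs (N div p) \<times> freqs (N div p). fst x + snd x \<noteq> 0}"
      and "y \<in> {x \<in> freqs (N div q) \<times> freqs (N div q). fst x + snd x \<noteq> 0}"
    then show "\<not> int Q dvd (fst x + snd x) * int p + (fst y + snd y) * int q"
      unfolding Q by (intro large_primes_not_dvd N assms) (auto dest!: freqsD)
  qed (simp add: Q)
  finally show ?thesis by (simp only: of_real_eq_0_iff)
qed

lemma abs_large_prime_le:
  assumes "p \<in> large_primes N"
  shows "\<bar>g p a\<bar> \<le> real (N div p)"
proof -
  have "\<bar>g p a\<bar> \<le> norm (\<Sum>j=1..N div p. w p j * grid_char Q (int j * int p) a)"
    unfolding g_def by (rule abs_Re_le_cmod)
  also have "\<dots> \<le> (\<Sum>j=1..N div p. 1)"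
    using w[OF assms] by (intro sum_norm_le) (simp add: norm_mult)
  finally show ?thesis by simp
qed

lemma large_prime_sq_le: "p \<in> large_primes N \<Longrightarrow> (g p a)\<^sup>2 \<le> (real (N div p))\<^sup>2"
  using abs_le_square_iff[of "g p a" "real (N div p)"] abs_large_prime_le[of p a] by simp

text \<open>By orthogonality of the centred squares only the diagonal remains, where each
  \<open>U p a\<close> is at most \<open>(N div p)^2\<close> in absolute value.\<close>

lemma sum_square_deviation_le:
  "(\<Sum>a<Q. ((\<Sum>p\<in>large_primes N. (g p a)\<^sup>2) - (\<Sum>p\<in>large_primes N. real (N div p)) / 2)\<^sup>2)
    \<le> real Q * (\<Sum>p\<in>large_primes N. real (N div p) ^ 4)"
proof -
  let ?P = "large_primes N"
  define U where "U = (\<lambda>p a. (g p a)\<^sup>2 - real (N div p) / 2)"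
  have U: "(U p a)\<^sup>2 \<le> real (N div p) ^ 4" if "p \<in> ?P" for p a
  proof -
    let ?n = "real (N div p)"
    have "(g p a)\<^sup>2 \<le> ?n\<^sup>2" by (rule large_prime_sq_le[OF that])
    moreover have "?n / 2 \<le> ?n\<^sup>2" by (cases "N div p") (auto simp: power2_eq_square field_simps)
    moreover have "0 \<le> (g p a)\<^sup>2" "0 \<le> ?n" by auto
    ultimately have "\<bar>U p a\<bar> \<le> \<bar>?n\<^sup>2\<bar>" unfolding U_def by linarith
    then have "(U p a)\<^sup>2 \<le> (?n\<^sup>2)\<^sup>2" by (simp only: abs_le_square_iff)
    then show ?thesis by simp
  qed
  have "(\<Sum>a<Q. ((\<Sum>p\<in>?P. (g p a)\<^sup>2) - (\<Sum>p\<in>?P. real (N div p)) / 2)\<^sup>2)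
      = (\<Sum>a<Q. \<Sum>p\<in>?P. \<Sum>q\<in>?P. U p a * U q a)"
    by (simp add: U_def power2_eq_square sum_product [symmetric] sum_subtractf sum_divide_distrib)
  also have "\<dots> = (\<Sum>p\<in>?P. \<Sum>a<Q. \<Sum>q\<in>?P. U p a * U q a)" by (rule sum.swap)
  also have "\<dots> = (\<Sum>p\<in>?P. \<Sum>q\<in>?P. \<Sum>a<Q. U p a * U q a)" by (intro sum.cong refl sum.swap)
  also have "\<dots> = (\<Sum>p\<in>?P. \<Sum>q\<in>?P. if p = q then \<Sum>a<Q. (U p a)\<^sup>2 else 0)"
    using sum_large_prime_sq_cross_eq_0
    by (intro sum.cong refl) (auto simp: U_def power2_eq_square)
  also have "\<dots> = (\<Sum>p\<in>?P. \<Sum>a<Q. (U p a)\<^sup>2)" by simp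
  also have "\<dots> \<le> (\<Sum>p\<in>?P. \<Sum>a<Q. real (N div p) ^ 4)" by (intro sum_mono U)
  finally show ?thesis by (simp add: sum_distrib_left)
qed

text \<open>Expand the square and separate the sums over \<open>a\<close> and \<open>b\<close>: the
  left side becomes the sum over \<open>p\<close> and \<open>q\<close> of
  \<open>(\<Sum>a<Q. g p a * g q a)^2\<close>, in which only \<open>p = q\<close> survives.\<close>

lemma sum_correlation_sq_le:
  "(\<Sum>a<Q. \<Sum>b<Q. (\<Sum>p\<in>large_primes N. g p a * g p b)\<^sup>2)
    \<le> (real Q)\<^sup>2 * (\<Sum>p\<in>large_primes N. real (N div p) ^ 4)"
proof -
  let ?P = "large_primes N"
  have "(\<Sum>a<Q. \<Sum>b<Q. (\<Sum>p\<in>?P. g p a * g p b)\<^sup>2)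
      = (\<Sum>a<Q. \<Sum>b<Q. \<Sum>p\<in>?P. \<Sum>q\<in>?P. (g p a * g q a) * (g p b * g q b))"
    by (simp add: power2_eq_square sum_product mult_ac)
  also have "\<dots> = (\<Sum>a<Q. \<Sum>p\<in>?P. \<Sum>b<Q. \<Sum>q\<in>?P. (g p a * g q a) * (g p b * g q b))"
    by (intro sum.cong refl sum.swap)
  also have "\<dots> = (\<Sum>p\<in>?P. \<Sum>a<Q. \<Sum>b<Q. \<Sum>q\<in>?P. (g p a * g q a) * (g p b * g q b))"
    by (rule sum.swap)
  also have "\<dots> = (\<Sum>p\<in>?P. \<Sum>a<Q. \<Sum>q\<in>?P. \<Sum>b<Q. (g p a * g q a) * (g p b * g q b))"
    by (intro sum.cong refl sum.swap)
  also have "\<dots> = (\<Sum>p\<in>?P. \<Sum>q\<in>?P. \<Sum>a<Q. \<Sum>b<Q. (g p a * g q a) * (g p b * g q b))"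
    by (intro sum.cong refl sum.swap)
  also have "\<dots> = (\<Sum>p\<in>?P. \<Sum>q\<in>?P. (\<Sum>a<Q. g p a * g q a)\<^sup>2)"
    unfolding power2_eq_square sum_product ..
  also have "\<dots> = (\<Sum>p\<in>?P. \<Sum>q\<in>?P. if p = q then (\<Sum>a<Q. (g p a)\<^sup>2)\<^sup>2 else 0)"
    using sum_large_prime_cross_eq_0 by (intro sum.cong refl) (auto simp: power2_eq_square)
  also have "\<dots> = (\<Sum>p\<in>?P. (\<Sum>a<Q. (g p a)\<^sup>2)\<^sup>2)" by simp
  also have "\<dots> \<le> (\<Sum>p\<in>?P. (real Q * real (N div p) ^ 2)\<^sup>2)"
  proof (intro sum_mono power_mono)
    fix p assume p: "p \<in> ?P"
    have "(\<Sum>a<Q. (g p a)\<^sup>2) \<le> (\<Sum>a<Q. real (N div p) ^ 2)"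
      by (intro sum_mono large_prime_sq_le p)
    then show "(\<Sum>a<Q. (g p a)\<^sup>2) \<le> real Q * real (N div p) ^ 2" by simp
  qed (auto intro: sum_nonneg)
  also have "\<dots> = (real Q)\<^sup>2 * (\<Sum>p\<in>?P. real (N div p) ^ 4)"
    by (simp add: power_mult_distrib sum_distrib_left)
  finally show ?thesis .
qed

end

text \<open>The cofactor \<open>j\<close> is smaller than every large prime, so \<open>p\<close> is
  the only large prime dividing \<open>j * p\<close>, and it does so once.\<close>

lemma flip_large_prime_mult:
  assumes N: "N \<ge> 16" and T: "T \<subseteq> large_primes N" and p: "p \<in> large_primes N" and j: "j \<in> {1..N div p}"
  shows "flip T (j * p) = flip_sign T p"
proof -
  have fin: "finite T" using T by (rule finite_subset) simp
  have pr: "prime p" using p by (simp add: large_primes_def)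
  have "(-1) ^ multiplicity q (j * p) = (if q = p then - 1 else (1::real))" if "q \<in> T" for q
  proof -
    have q: "q \<in> large_primes N" "prime q" using that T by (auto simp: large_primes_def)
    have "\<not> q dvd j"
      using j large_primes_two_div_less[OF N p q(1)] by (auto dest!: dvd_imp_le)
    then have "multiplicity q j = 0" by (rule not_dvd_imp_multiplicity_0)
    moreover have "multiplicity q (j * p) = multiplicity q j + multiplicity q p"
      using q pr j by (intro prime_elem_multiplicity_mult_distrib) (auto simp: prime_gt_0_nat)
    moreover have "multiplicity q p = (if q = p then 1 else 0)"
      using q pr by (auto simp: prime_multiplicity_other)
    ultimately show ?thesis by simp
  qed
  then have "flip T (j * p) = (\<Prod>q\<in>T. if q = p then - 1 else 1)"
    unfolding flip_def by (intro prod.cong refl) auto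
  then show ?thesis using fin by (simp add: flip_sign_def)
qed

text \<open>Every \<open>n \<le> N\<close> either lies in \<open>R\<close>, where no flip acts, or
  is \<open>j * p\<close> for exactly one large prime \<open>p\<close>, where the flip acts by the
  sign of \<open>p\<close>. The polynomial thus becomes a fixed part plus a linear form in the
  signs.\<close>

lemma sum_flip_large_prime_split:
  fixes h :: "nat \<Rightarrow> complex"
  assumes N: "N \<ge> 16" and T: "T \<subseteq> large_primes N"
  defines "R \<equiv> {n\<in>{1..N}. \<forall>p\<in>large_primes N. \<not> p dvd n}"
  shows "(\<Sum>n=1..N. of_real (flip T n) * h n) =
    (\<Sum>n\<in>R. h n) + (\<Sum>p\<in>large_primes N. of_real (flip_sign T p) * (\<Sum>j=1..N div p. h (j * p)))"
proof -
  let ?P = "large_primes N"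
  define D where "D = Sigma ?P (\<lambda>p. {1..N div p})"
  have fin: "finite D" by (simp add: D_def)
  have pos: "p > 0" if "p \<in> ?P" for p using that by (auto simp: large_primes_def prime_gt_0_nat)
  have inj: "inj_on (\<lambda>(p, j). j * p) D"
  proof (rule inj_onI, clarify)
    fix p j q k assume D: "(p, j) \<in> D" "(q, k) \<in> D" and eq: "j * p = k * q"
    have pq: "p \<in> ?P" "q \<in> ?P" using D by (auto simp: D_def)
    have "p = q"
    proof (rule ccontr)
      assume "p \<noteq> q"
      moreover have "prime p" "prime q" using pq by (auto simp: large_primes_def)
      moreover have "p dvd k * q" using eq by (metis dvd_triv_right)
      ultimately have "p dvd k" by (auto simp: prime_dvd_mult_iff primes_dvd_imp_eq)
      then have "p \<le> k" using D by (auto simp: D_def intro: dvd_imp_le)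
      then show False using large_primes_two_div_less[OF N pq(2,1)] D by (auto simp: D_def)
    qed
    then show "p = q \<and> j = k" using eq pos[OF pq(1)] by simp
  qed
  have split: "{1..N} = R \<union> (\<lambda>(p, j). j * p) ` D" "R \<inter> (\<lambda>(p, j). j * p) ` D = {}"
  proof -
    show "R \<inter> (\<lambda>(p, j). j * p) ` D = {}" by (auto simp: R_def D_def)
    have "(\<lambda>(p, j). j * p) ` D \<subseteq> {1..N}"
      using pos by (auto simp: D_def less_eq_div_iff_mult_less_eq Suc_le_eq)
    moreover have "n \<in> (\<lambda>(p, j). j * p) ` D" if n: "n \<in> {1..N}" "n \<notin> R" for n
    proof -
      obtain p where p: "p \<in> ?P" "p dvd n" using n by (auto simp: R_def)
      then obtain j where j: "n = j * p" by (metis dvd_def mult.commute)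
      then have "(p, j) \<in> D" using n p pos[OF p(1)]
        by (auto simp: D_def less_eq_div_iff_mult_less_eq intro!: Nat.gr0I simp: Suc_le_eq)
      then show ?thesis using j by (auto intro: rev_image_eqI)
    qed
    moreover have "R \<subseteq> {1..N}" by (auto simp: R_def)
    ultimately show "{1..N} = R \<union> (\<lambda>(p, j). j * p) ` D" by blast
  qed
  have finR: "finite R" by (simp add: R_def)
  have "(\<Sum>n=1..N. of_real (flip T n) * h n) =
      (\<Sum>n\<in>R. of_real (flip T n) * h n) + (\<Sum>n\<in>(\<lambda>(p, j). j * p) ` D. of_real (flip T n) * h n)"
    unfolding split(1) by (rule sum.union_disjoint) (use finR fin split(2) in auto)
  also have "(\<Sum>n\<in>R. of_real (flip T n) * h n) = (\<Sum>n\<in>R. h n)"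
  proof (rule sum.cong [OF refl])
    fix n assume "n \<in> R"
    then have "multiplicity p n = 0" if "p \<in> T" for p
      using that T by (intro not_dvd_imp_multiplicity_0) (auto simp: R_def)
    then show "of_real (flip T n) * h n = h n" by (simp add: flip_def)
  qed
  also have "(\<Sum>n\<in>(\<lambda>(p, j). j * p) ` D. of_real (flip T n) * h n)
      = (\<Sum>(p, j)\<in>D. of_real (flip T (j * p)) * h (j * p))"
    using inj by (simp add: sum.reindex case_prod_unfold)
  also have "\<dots> = (\<Sum>(p, j)\<in>D. of_real (flip_sign T p) * h (j * p))"
    by (intro sum.cong refl) (auto simp: D_def flip_large_prime_mult[OF N T])
  also have "\<dots> = (\<Sum>p\<in>?P. of_real (flip_sign T p) * (\<Sum>j=1..N div p. h (j * p)))"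
    unfolding D_def by (simp add: sum.Sigma [symmetric] sum_distrib_left)
  finally show ?thesis .
qed

text \<open>Apply \<open>card_signs_small_max_le\<close> to the set \<open>S\<close> of good grid
  points, where the fixed part \<open>A\<close> is at most \<open>2 * sqrt N\<close> and the sum
  \<open>D\<close> of squares lies within \<open>V / 4\<close> of \<open>V / 2\<close>. Since
  \<open>S\<close> contains at least half of the grid, passing from the grid average of the
  correlations to that over \<open>S\<close> costs the factor 4 in \<open>4 * B\<close>.\<close>

lemma card_flips_small_max_le:
  fixes f :: "nat \<Rightarrow> complex" and N :: nat and l \<mu> :: real
  defines "P \<equiv> large_primes N" and "Q \<equiv> 8 * N + 1"
  defines "V \<equiv> \<Sum>p\<in>P. real (N div p)" and "B \<equiv> \<Sum>p\<in>P. real (N div p) ^ 4"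
  assumes N: "N \<ge> 16"
  assumes f: "\<And>n. n \<in> {1..N} \<Longrightarrow> norm (f n) = 1"
  assumes V: "V > 0" "64 * B \<le> V\<^sup>2"
  assumes l: "l > 0" "\<And>p. p \<in> P \<Longrightarrow> l * real (N div p) \<le> 1 / 2" and mu: "\<mu> > 0"
  shows "real (card {T\<in>Pow P. \<forall>a<Q. norm (\<Sum>n=1..N. of_real (flip T n) * (f n * e2pi (real n * (real a / real Q))))
      < l * V / 16 - 1 / l - 2 * sqrt (real N)})
    \<le> 2 ^ card P * (4 * (exp (l\<^sup>2 * V) * (\<mu> + l ^ 4 * (4 * B) / \<mu>)))"
proof -
  define w where "w = (\<lambda>p j. f (j * p))"
  define g where "g = (\<lambda>p a. Re (\<Sum>j=1..N div p. w p j * grid_char Q (int j * int p) a))"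
  have w: "norm (w p j) = 1" if "p \<in> large_primes N" "j \<in> {1..N div p}" for p j
  proof -
    have "p > 0" using that by (auto simp: large_primes_def prime_gt_0_nat)
    then show ?thesis using that unfolding w_def
      by (intro f) (auto simp: less_eq_div_iff_mult_less_eq Suc_le_eq)
  qed
  have Q: "Q = 8 * N + 1" "Q > 0" by (auto simp: Q_def)
  define R where "R = {n\<in>{1..N}. \<forall>p\<in>P. \<not> p dvd n}"
  define A where "A = (\<lambda>a. \<Sum>n\<in>R. f n * grid_char Q (int n) a)"
  define D where "D = (\<lambda>a. \<Sum>p\<in>P. (g p a)\<^sup>2)"
  define S where "S = {a\<in>{..<Q}. norm (A a) \<le> 2 * sqrt (real N) \<and> \<bar>D a - V / 2\<bar> \<le> V / 4}"
  define S1 where "S1 = {a\<in>{..<Q}. norm (A a) > 2 * sqrt (real N)}"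
  define S2 where "S2 = {a\<in>{..<Q}. \<bar>D a - V / 2\<bar> > V / 4}"
  have finP: "finite P" by (simp add: P_def)
  have finS: "finite S" "finite S1" "finite S2" by (auto simp: S_def S1_def S2_def)
  \<comment> \<open>By Parseval the mean square of \<open>A\<close> is at most \<open>N\<close>, so
    \<open>norm (A a)\<close> exceeds \<open>2 * sqrt N\<close> on at most a quarter of the
    grid.\<close>
  have "real (card S1) * (4 * real N) \<le> real Q * real N"
  proof -
    have "real (card S1) * (4 * real N) = (\<Sum>a\<in>S1. 4 * real N)" by simp
    also have "\<dots> \<le> (\<Sum>a\<in>S1. (norm (A a))\<^sup>2)"
    proof (rule sum_mono)
      fix a assume "a \<in> S1"
      then have "(2 * sqrt (real N))\<^sup>2 \<le> (norm (A a))\<^sup>2" by (intro power_mono) (auto simp: S1_def)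
      then show "4 * real N \<le> (norm (A a))\<^sup>2" by (simp add: power_mult_distrib)
    qed
    also have "\<dots> \<le> (\<Sum>a<Q. (norm (A a))\<^sup>2)" by (intro sum_mono2) (auto simp: S1_def)
    also have "\<dots> = real Q * (\<Sum>n\<in>R. (norm (f n))\<^sup>2)"
      unfolding A_def
    proof (rule sum_norm_sq_grid_poly)
      fix m n assume mn: "m \<in> R" "n \<in> R" "m \<noteq> n"
      show "\<not> int Q dvd int m - int n"
      proof
        assume "int Q dvd int m - int n"
        then have "\<bar>int Q\<bar> \<le> \<bar>int m - int n\<bar>" using mn by (intro dvd_imp_le_int) auto
        then show False using mn by (auto simp: R_def Q)
      qed
    qed (auto simp: R_def Q)
    also have "(\<Sum>n\<in>R. (norm (f n))\<^sup>2) = real (card R)"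
      using f by (simp add: R_def)
    also have "card R \<le> card {1..N}" by (rule card_mono) (auto simp: R_def)
    finally show ?thesis by (simp add: mult_left_mono)
  qed
  then have S1: "real (card S1) \<le> real Q / 4" using N by (simp add: field_simps)
  \<comment> \<open>Chebyshev's inequality for \<open>D\<close>; the hypothesis
    \<open>64 * B \<le> V^2\<close> is what makes this exceptional set at most a quarter of the grid
    too.\<close>
  have "real (card S2) * (V / 4)\<^sup>2 \<le> real Q * B"
  proof -
    have "real (card S2) * (V / 4)\<^sup>2 = (\<Sum>a\<in>S2. (V / 4)\<^sup>2)" by simp
    also have "\<dots> \<le> (\<Sum>a\<in>S2. (D a - V / 2)\<^sup>2)"
    proof (rule sum_mono)
      fix a assume "a \<in> S2"
      then show "(V / 4)\<^sup>2 \<le> (D a - V / 2)\<^sup>2"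
        using V by (intro abs_le_square_iff [THEN iffD1]) (auto simp: S2_def)
    qed
    also have "\<dots> \<le> (\<Sum>a<Q. (D a - V / 2)\<^sup>2)" by (intro sum_mono2) (auto simp: S2_def)
    also have "\<dots> \<le> real Q * B"
      unfolding D_def V_def B_def P_def g_def by (rule sum_square_deviation_le[OF N Q(1) w])
    finally show ?thesis .
  qed
  also have "real Q * B \<le> real Q / 4 * (V / 4)\<^sup>2"
    using mult_left_mono[OF V(2), of "real Q / 64"] by (simp add: power2_eq_square field_simps)
  finally have S2: "real (card S2) \<le> real Q / 4" using V by (simp add: field_simps)
  have "real Q = real (card {..<Q})" by simp
  also have "card {..<Q} \<le> card (S \<union> S1 \<union> S2)"
    using finS by (intro card_mono) (auto simp: S_def S1_def S2_def)
  also have "\<dots> \<le> card S + card S1 + card S2"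
    using card_Un_le[of "S \<union> S1" S2] card_Un_le[of S S1] by linarith
  finally have S: "real (card S) \<ge> real Q / 2" using S1 S2 by simp
  then have S0: "S \<noteq> {}" using Q by auto
  have SQ: "S \<subseteq> {..<Q}" by (auto simp: S_def)
  have "(\<Sum>a\<in>S. \<Sum>b\<in>S. (\<Sum>p\<in>P. g p a * g p b)\<^sup>2) \<le> (\<Sum>a<Q. \<Sum>b<Q. (\<Sum>p\<in>P. g p a * g p b)\<^sup>2)"
    using SQ by (intro order.trans[OF sum_mono sum_mono2] sum_mono2) (auto intro!: sum_nonneg)
  also have "\<dots> \<le> (real Q)\<^sup>2 * B"
    unfolding B_def P_def g_def by (rule sum_correlation_sq_le[OF N Q(1) w])
  also have "\<dots> \<le> (2 * real (card S))\<^sup>2 * B"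
    using S by (intro mult_right_mono power_mono) (auto simp: B_def intro: sum_nonneg)
  finally have C: "(\<Sum>a\<in>S. \<Sum>b\<in>S. (\<Sum>p\<in>P. g p a * g p b)\<^sup>2) \<le> (real (card S))\<^sup>2 * (4 * B)"
    by (simp add: power_mult_distrib)
  \<comment> \<open>At a point of \<open>S\<close> the fixed part can hide at most
    \<open>2 * sqrt N\<close>, so where the polynomial is small the linear form in the signs is
    below the threshold.\<close>
  have "{T\<in>Pow P. \<forall>a<Q. norm (\<Sum>n=1..N. of_real (flip T n) * (f n * e2pi (real n * (real a / real Q))))
      < l * V / 16 - 1 / l - 2 * sqrt (real N)}
     \<subseteq> {T\<in>Pow P. \<forall>a\<in>S. (\<Sum>p\<in>P. flip_sign T p * g p a) < l * V / 16 - 1 / l}"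
  proof (safe)
    fix T a assume T: "T \<subseteq> P" and a: "a \<in> S"
      and lt: "\<forall>a<Q. norm (\<Sum>n=1..N. of_real (flip T n) * (f n * e2pi (real n * (real a / real Q))))
      < l * V / 16 - 1 / l - 2 * sqrt (real N)"
    let ?z = "\<Sum>n=1..N. of_real (flip T n) * (f n * grid_char Q (int n) a)"
    have "?z = A a + (\<Sum>p\<in>P. of_real (flip_sign T p) * (\<Sum>j=1..N div p. w p j * grid_char Q (int j * int p) a))"
      using sum_flip_large_prime_split[OF N, of T "\<lambda>n. f n * grid_char Q (int n) a"] T
      by (simp add: A_def R_def P_def w_def)
    then have "Re ?z = Re (A a) + (\<Sum>p\<in>P. flip_sign T p * g p a)"
      by (simp add: g_def)
    moreover have "- Re (A a) \<le> norm (A a)" using abs_Re_le_cmod[of "A a"] by linarith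
    moreover have "norm (A a) \<le> 2 * sqrt (real N)" using a by (simp add: S_def)
    moreover have "Re ?z \<le> norm ?z" by (rule complex_Re_le_cmod)
    moreover have "norm ?z < l * V / 16 - 1 / l - 2 * sqrt (real N)"
      using lt a by (auto simp: S_def grid_char_def)
    ultimately show "(\<Sum>p\<in>P. flip_sign T p * g p a) < l * V / 16 - 1 / l" by linarith
  qed
  then have "real (card {T\<in>Pow P. \<forall>a<Q. norm (\<Sum>n=1..N. of_real (flip T n) * (f n * e2pi (real n * (real a / real Q))))
      < l * V / 16 - 1 / l - 2 * sqrt (real N)})
     \<le> real (card {T\<in>Pow P. \<forall>a\<in>S. (\<Sum>p\<in>P. flip_sign T p * g p a) < l * V / 16 - 1 / l})"
    using finP by (subst of_nat_le_iff, intro card_mono) auto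
  also have "\<dots> \<le> 2 ^ card P * (4 * (exp (l\<^sup>2 * V) * (\<mu> + l ^ 4 * (4 * B) / \<mu>)))"
  proof (rule card_signs_small_max_le[OF finP finS(1) S0 l(1) mu _ _ _ C])
    fix p a assume p: "p \<in> P"
    have "\<bar>g p a\<bar> \<le> real (N div p)"
      unfolding g_def by (rule abs_large_prime_le[OF N Q(1) w p[unfolded P_def]])
    then have "l * \<bar>g p a\<bar> \<le> l * real (N div p)" using l(1) by simp
    moreover have "\<bar>l * g p a\<bar> = l * \<bar>g p a\<bar>" using l(1) by (simp add: abs_mult)
    ultimately show "\<bar>l * g p a\<bar> \<le> 1 / 2" using l(2)[OF p] by linarith
  next
    fix a assume "a \<in> S"
    then have "\<bar>D a - V / 2\<bar> \<le> V / 4" by (simp add: S_def)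
    then show "V / 4 \<le> (\<Sum>p\<in>P. (g p a)\<^sup>2)" "(\<Sum>p\<in>P. (g p a)\<^sup>2) \<le> V"
      using V unfolding D_def by linarith+
  qed
  finally show ?thesis .
qed

section \<open>Symmetric random multiplicative functions\<close>

text \<open>The properties shared by the two models. With independence they make the joint law of
  the values at primes invariant under sign flips.\<close>

locale symmetric_multiplicative = random_multiplicative +
  assumes distr_uminus_prime: "\<And>p. prime p \<Longrightarrow> distr M borel (\<lambda>\<omega>. - X p \<omega>) = distr M borel (X p)"
    and AE_norm_prime: "\<And>p. prime p \<Longrightarrow> AE \<omega> in M. norm (X p \<omega>) = 1"

section \<open>Measurability\<close>

context random_multiplicative
begin

lemma measurable_prime [measurable]: "prime p \<Longrightarrow> X p \<in> borel_measurable M"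
  using indep_primes by (auto simp: indep_vars_def)

lemma measurable_X: "n > 0 \<Longrightarrow> X n \<in> borel_measurable M"
proof (subst measurable_cong[OF prime_factors_prod])
  show "(\<lambda>\<omega>. \<Prod>p\<in>prime_factors n. X p \<omega> ^ multiplicity p n) \<in> borel_measurable M"
    by (intro borel_measurable_prod borel_measurable_power measurable_prime) (auto simp: in_prime_factors_iff)
qed auto

lemma measurable_rand_poly: "(\<lambda>\<omega>. rand_poly X N \<omega> \<theta>) \<in> borel_measurable M"
  unfolding rand_poly_def
  by (intro borel_measurable_times borel_measurable_sum borel_measurable_const measurable_X) auto

text \<open>By continuity in \<open>\<theta>\<close> a bound on the maximum need only be tested at
  the countably many rational points.\<close>

lemma measurable_max_rand_poly: "max_rand_poly X N \<in> borel_measurable M"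
proof (subst borel_measurable_iff_le, rule allI)
  fix c :: real
  have "max_rand_poly X N \<omega> \<le> c \<longleftrightarrow> (\<forall>q\<in>\<rat>. norm (rand_poly X N \<omega> q) \<le> c)" for \<omega>
  proof
    assume le: "\<forall>q\<in>\<rat>. norm (rand_poly X N \<omega> q) \<le> c"
    have "continuous_on UNIV (\<lambda>\<theta>. norm (rand_poly X N \<omega> \<theta>))"
      unfolding rand_poly_def e2pi_def by (intro continuous_intros)
    then have "closed {\<theta>. norm (rand_poly X N \<omega> \<theta>) \<le> c}"
      by (intro closed_Collect_le continuous_on_const)
    moreover have "\<rat> \<subseteq> {\<theta>. norm (rand_poly X N \<omega> \<theta>) \<le> c}" using le by auto
    ultimately have "closure \<rat> \<subseteq> {\<theta>. norm (rand_poly X N \<omega> \<theta>) \<le> c}" by (intro closure_minimal)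
    then have "norm (rand_poly X N \<omega> \<theta>) \<le> c" for \<theta> by (auto simp: Rats_closure_real)
    then show "max_rand_poly X N \<omega> \<le> c" using max_rand_poly_attained[of X N \<omega>] by metis
  next
    assume "max_rand_poly X N \<omega> \<le> c"
    then show "\<forall>q\<in>\<rat>. norm (rand_poly X N \<omega> q) \<le> c"
      using max_rand_poly_attained[of X N \<omega>] by (meson order_trans)
  qed
  then have "{\<omega> \<in> space M. max_rand_poly X N \<omega> \<le> c} = {\<omega> \<in> space M. \<forall>q\<in>\<rat>. norm (rand_poly X N \<omega> q) \<le> c}"
    by simp
  also have "\<dots> \<in> sets M"
    using measurable_rand_poly[of N]
    by (intro sets.sets_Collect_countable_All' countable_rat) measurable
  finally show "{\<omega> \<in> space M. max_rand_poly X N \<omega> \<le> c} \<in> sets M" .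
qed

end

section \<open>Invariance under sign flips\<close>

context symmetric_multiplicative
begin

lemma AE_norm_X: "AE \<omega> in M. \<forall>n>0. norm (X n \<omega>) = 1"
proof -
  have "AE \<omega> in M. \<forall>p. prime p \<longrightarrow> norm (X p \<omega>) = 1"
    unfolding AE_all_countable using AE_norm_prime by auto
  then show ?thesis
  proof (rule AE_mp, intro AE_I2 impI allI)
    fix \<omega> n assume "\<omega> \<in> space M" "\<forall>p. prime p \<longrightarrow> norm (X p \<omega>) = 1" "n > (0::nat)"
    then show "norm (X n \<omega>) = 1"
      by (simp add: prime_factors_prod prod_norm [symmetric] norm_power in_prime_factors_iff)
  qed
qed

lemma distr_flip_sign_prime:
  assumes "prime p"
  shows "distr M borel (\<lambda>\<omega>. of_real (flip_sign T p) * X p \<omega>) = distr M borel (X p)"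
  using distr_uminus_prime[OF assms] by (simp add: flip_sign_def)

text \<open>By independence both joint laws are products of their marginals, and the marginals agree
  by symmetry.\<close>

lemma joint_distr_flip_sign:
  assumes "I \<noteq> {}" "\<And>p. p \<in> I \<Longrightarrow> prime p"
  shows "distr M (Pi\<^sub>M I (\<lambda>_. borel)) (\<lambda>\<omega>. \<lambda>p\<in>I. of_real (flip_sign T p) * X p \<omega>)
    = distr M (Pi\<^sub>M I (\<lambda>_. borel)) (\<lambda>\<omega>. \<lambda>p\<in>I. X p \<omega>)"
proof -
  have ind: "indep_vars (\<lambda>_. borel) X I"
    using indep_primes by (rule indep_vars_subset) (use assms in auto)
  have ind': "indep_vars (\<lambda>_. borel) (\<lambda>p \<omega>. of_real (flip_sign T p) * X p \<omega>) I"
    using indep_vars_compose2[OF ind, of "\<lambda>p z. of_real (flip_sign T p) * z" "\<lambda>_. borel"] by simp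
  have "distr M (Pi\<^sub>M I (\<lambda>_. borel)) (\<lambda>\<omega>. \<lambda>p\<in>I. of_real (flip_sign T p) * X p \<omega>)
      = Pi\<^sub>M I (\<lambda>p. distr M borel (\<lambda>\<omega>. of_real (flip_sign T p) * X p \<omega>))"
    using ind' by (subst (asm) indep_vars_iff_distr_eq_PiM') (use assms in auto)
  also have "\<dots> = Pi\<^sub>M I (\<lambda>p. distr M borel (X p))"
    by (intro PiM_cong refl distr_flip_sign_prime assms)
  also have "\<dots> = distr M (Pi\<^sub>M I (\<lambda>_. borel)) (\<lambda>\<omega>. \<lambda>p\<in>I. X p \<omega>)"
    using ind by (subst (asm) indep_vars_iff_distr_eq_PiM') (use assms in auto)
  finally show ?thesis .
qed

lemma flip_eq_prod_flip_sign:
  assumes "finite T" "\<And>p. p \<in> T \<Longrightarrow> prime p" "n > 0"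
  shows "flip T n = (\<Prod>p\<in>prime_factors n. flip_sign T p ^ multiplicity p n)"
proof -
  have "flip T n = (\<Prod>p\<in>T \<inter> prime_factors n. (-1) ^ multiplicity p n)"
    unfolding flip_def
  proof (rule prod.mono_neutral_right)
    show "\<forall>p\<in>T - T \<inter> prime_factors n. (- 1) ^ multiplicity p n = (1::real)"
    proof
      fix p assume "p \<in> T - T \<inter> prime_factors n"
      then have "\<not> p dvd n" using assms by (auto simp: in_prime_factors_iff)
      then show "(- 1) ^ multiplicity p n = (1::real)" by (simp add: not_dvd_imp_multiplicity_0)
    qed
  qed (use assms in auto)
  also have "\<dots> = (\<Prod>p\<in>prime_factors n. flip_sign T p ^ multiplicity p n)"
    by (intro prod.mono_neutral_cong_left) (auto simp: flip_sign_def)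
  finally show ?thesis .
qed

text \<open>The vector of \<open>X 1\<close>, ..., \<open>X N\<close> is a fixed measurable function
  \<open>\<Psi>\<close> of the values at primes up to \<open>N\<close>, and multiplying it by
  \<open>flip T\<close> amounts to flipping the arguments of \<open>\<Psi>\<close>. So the
  invariance of the joint law at primes carries over.\<close>

lemma prob_flip:
  assumes N: "N \<ge> 2" and T: "finite T" "\<And>p. p \<in> T \<Longrightarrow> prime p"
    and D: "D \<in> sets (Pi\<^sub>M {1..N} (\<lambda>_. borel))"
  shows "prob {\<omega> \<in> space M. (\<lambda>n\<in>{1..N}. of_real (flip T n) * X n \<omega>) \<in> D}
    = prob {\<omega> \<in> space M. (\<lambda>n\<in>{1..N}. X n \<omega>) \<in> D}"
proof -
  define I where "I = {p. prime p \<and> p \<le> N}"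
  define \<Psi> :: "(nat \<Rightarrow> complex) \<Rightarrow> nat \<Rightarrow> complex"
    where "\<Psi> = (\<lambda>x. \<lambda>n\<in>{1..N}. \<Prod>p\<in>prime_factors n. x p ^ multiplicity p n)"
  have pf: "p \<in> I" if "p \<in> prime_factors n" "n \<in> {1..N}" for p n
    using that by (auto simp: I_def in_prime_factors_iff dest!: dvd_imp_le)
  have \<Psi>: "\<Psi> \<in> measurable (Pi\<^sub>M I (\<lambda>_. borel)) (Pi\<^sub>M {1..N} (\<lambda>_. borel))"
    unfolding \<Psi>_def
    by (intro measurable_restrict borel_measurable_prod borel_measurable_power measurable_component_singleton pf) auto
  have meas: "(\<lambda>\<omega>. \<lambda>p\<in>I. of_real (flip_sign T' p) * X p \<omega>) \<in> measurable M (Pi\<^sub>M I (\<lambda>_. borel))" for T' :: "nat set"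
    by (intro measurable_restrict borel_measurable_times borel_measurable_const measurable_prime) (auto simp: I_def)
  have eq: "(\<lambda>n\<in>{1..N}. of_real (flip T' n) * X n \<omega>) = \<Psi> (\<lambda>p\<in>I. of_real (flip_sign T' p) * X p \<omega>)"
    if "\<omega> \<in> space M" "finite T'" "\<And>p. p \<in> T' \<Longrightarrow> prime p" for \<omega> T'
  proof (rule ext)
    fix n
    show "(\<lambda>n\<in>{1..N}. of_real (flip T' n) * X n \<omega>) n = \<Psi> (\<lambda>p\<in>I. of_real (flip_sign T' p) * X p \<omega>) n"
    proof (cases "n \<in> {1..N}")
      case True
      have "\<Psi> (\<lambda>p\<in>I. of_real (flip_sign T' p) * X p \<omega>) n
          = (\<Prod>p\<in>prime_factors n. (of_real (flip_sign T' p) * X p \<omega>) ^ multiplicity p n)"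
        using True pf[OF _ True] by (simp add: \<Psi>_def)
      also have "\<dots> = of_real (flip T' n) * X n \<omega>"
        using True that flip_eq_prod_flip_sign[of T' n] prime_factors_prod[of n \<omega>]
        by (simp add: power_mult_distrib prod.distrib)
      finally show ?thesis using True by simp
    next
      case False
      then show ?thesis unfolding \<Psi>_def restrict_def by (simp only: False if_False)
    qed
  qed
  have prob_eq: "prob {\<omega> \<in> space M. (\<lambda>n\<in>{1..N}. of_real (flip T' n) * X n \<omega>) \<in> D}
     = measure (distr M (Pi\<^sub>M I (\<lambda>_. borel)) (\<lambda>\<omega>. \<lambda>p\<in>I. of_real (flip_sign T' p) * X p \<omega>))
        (\<Psi> -` D \<inter> space (Pi\<^sub>M I (\<lambda>_. borel)))"
    if "finite T'" "\<And>p. p \<in> T' \<Longrightarrow> prime p" for T'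
  proof -
    have "{\<omega> \<in> space M. (\<lambda>n\<in>{1..N}. of_real (flip T' n) * X n \<omega>) \<in> D}
       = (\<lambda>\<omega>. \<lambda>p\<in>I. of_real (flip_sign T' p) * X p \<omega>) -` (\<Psi> -` D \<inter> space (Pi\<^sub>M I (\<lambda>_. borel))) \<inter> space M"
      using eq[OF _ that] measurable_space[OF meas] by auto
    then show ?thesis
      by (simp add: measure_distr[OF meas measurable_sets[OF \<Psi> D]])
  qed
  have "I \<noteq> {}" using N two_is_prime_nat unfolding I_def by blast
  then have "distr M (Pi\<^sub>M I (\<lambda>_. borel)) (\<lambda>\<omega>. \<lambda>p\<in>I. of_real (flip_sign T' p) * X p \<omega>)
      = distr M (Pi\<^sub>M I (\<lambda>_. borel)) (\<lambda>\<omega>. \<lambda>p\<in>I. X p \<omega>)" for T' :: "nat set"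
    by (rule joint_distr_flip_sign) (auto simp: I_def)
  then have "prob {\<omega> \<in> space M. (\<lambda>n\<in>{1..N}. of_real (flip T n) * X n \<omega>) \<in> D}
      = prob {\<omega> \<in> space M. (\<lambda>n\<in>{1..N}. of_real (flip {} n) * X n \<omega>) \<in> D}"
    using prob_eq[OF T] prob_eq[of "{}"] by simp
  then show ?thesis by (simp add: flip_def)
qed

text \<open>Averaging \<open>prob_flip\<close> over all \<open>T \<subseteq> I\<close> writes the
  probability as the expected proportion of flips that lead into \<open>D\<close>. For almost every
  outcome the values of \<open>X\<close> are unimodular, and the counting hypothesis bounds that
  proportion.\<close>

lemma prob_le_flip_average:
  assumes N: "N \<ge> 2" and I: "finite I" "\<And>p. p \<in> I \<Longrightarrow> prime p"
    and D: "D \<in> sets (Pi\<^sub>M {1..N} (\<lambda>_. borel))"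
    and le: "\<And>f. (\<And>n. n \<in> {1..N} \<Longrightarrow> norm (f n) = 1) \<Longrightarrow>
      real (card {T \<in> Pow I. (\<lambda>n\<in>{1..N}. of_real (flip T n) * f n) \<in> D}) \<le> 2 ^ card I * \<eta>"
  shows "prob {\<omega> \<in> space M. (\<lambda>n\<in>{1..N}. X n \<omega>) \<in> D} \<le> \<eta>"
proof -
  define E where "E = (\<lambda>T. {\<omega> \<in> space M. (\<lambda>n\<in>{1..N}. of_real (flip T n) * X n \<omega>) \<in> D})"
  have E: "E T \<in> sets M" for T
  proof -
    have "(\<lambda>\<omega>. \<lambda>n\<in>{1..N}. of_real (flip T n) * X n \<omega>) \<in> measurable M (Pi\<^sub>M {1..N} (\<lambda>_. borel))"
      by (intro measurable_restrict borel_measurable_times borel_measurable_const measurable_X) auto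
    from measurable_sets[OF this D] show ?thesis by (simp add: E_def vimage_def Int_def conj_commute)
  qed
  have "2 ^ card I * prob {\<omega> \<in> space M. (\<lambda>n\<in>{1..N}. X n \<omega>) \<in> D} = (\<Sum>T\<in>Pow I. prob (E T))"
  proof -
    have "prob (E T) = prob {\<omega> \<in> space M. (\<lambda>n\<in>{1..N}. X n \<omega>) \<in> D}" if "T \<in> Pow I" for T
      unfolding E_def using that I by (intro prob_flip[OF N _ _ D]) (auto intro: finite_subset)
    then show ?thesis using I by (simp add: card_Pow)
  qed
  also have "\<dots> = expectation (\<lambda>\<omega>. \<Sum>T\<in>Pow I. indicator (E T) \<omega>)"
    using E by (subst Bochner_Integration.integral_sum)
      (auto intro!: integrable_real_indicator simp: emeasure_eq_measure)
  also have "\<dots> \<le> expectation (\<lambda>\<omega>. 2 ^ card I * \<eta>)"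
  proof (rule integral_mono_AE)
    show "integrable M (\<lambda>\<omega>. \<Sum>T\<in>Pow I. indicator (E T) \<omega> :: real)"
      using E by (intro Bochner_Integration.integrable_sum integrable_real_indicator)
        (auto simp: emeasure_eq_measure)
    show "AE \<omega> in M. (\<Sum>T\<in>Pow I. indicator (E T) \<omega>) \<le> 2 ^ card I * \<eta>"
      using AE_norm_X
    proof (rule AE_mp, intro AE_I2 impI)
      fix \<omega> assume \<omega>: "\<omega> \<in> space M" "\<forall>n>0. norm (X n \<omega>) = 1"
      have "(\<Sum>T\<in>Pow I. indicator (E T) \<omega>) = (\<Sum>T\<in>Pow I. if \<omega> \<in> E T then 1 else 0 :: real)"
        by (intro sum.cong) (auto simp: indicator_def)
      also have "\<dots> = real (card {T \<in> Pow I. \<omega> \<in> E T})"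
        using I by (simp add: sum.inter_filter [symmetric])
      also have "{T \<in> Pow I. \<omega> \<in> E T} = {T \<in> Pow I. (\<lambda>n\<in>{1..N}. of_real (flip T n) * X n \<omega>) \<in> D}"
        using \<omega> by (simp add: E_def)
      also have "real (card \<dots>) \<le> 2 ^ card I * \<eta>"
        using \<omega> by (intro le) auto
      finally show "(\<Sum>T\<in>Pow I. indicator (E T) \<omega>) \<le> 2 ^ card I * \<eta>" .
    qed
  qed simp
  finally show ?thesis by (simp add: prob_space)
qed

end

section \<open>The Rademacher and Steinhaus models\<close>

lemma rademacher_imp_symmetric:
  assumes "rademacher_multiplicative M X"
  shows "symmetric_multiplicative M X"
proof -
  interpret rademacher_multiplicative M X by fact
  show ?thesis
  proof
    fix p :: nat assume p: "prime p"
    note [measurable] = measurable_prime[OF p]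
    let ?A = "{\<omega> \<in> space M. X p \<omega> = 1}" and ?B = "{\<omega> \<in> space M. X p \<omega> = -1}"
    have sets: "?A \<in> sets M" "?B \<in> sets M" by measurable
    have "prob (?A \<union> ?B) = 1 / 2 + 1 / 2"
      unfolding prob_prime_1[OF p, symmetric] prob_prime_minus_1[OF p, symmetric]
      using prob_prime_1[OF p] prob_prime_minus_1[OF p] sets
      by (subst finite_measure_Union) auto
    then have "prob (?A \<union> ?B) = 1" by simp
    then have AE: "AE \<omega> in M. \<omega> \<in> ?A \<union> ?B" using sets by (subst (asm) prob_eq_1) auto
    then show "AE \<omega> in M. norm (X p \<omega>) = 1" by eventually_elim auto
    \<comment> \<open>Stated for general \<open>c\<close> in order to be read at
      \<open>c = 1\<close> and \<open>c = - 1\<close>: the right side does not change under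
      \<open>c \<mapsto> - c\<close>.\<close>
    have law: "emeasure (distr M borel (\<lambda>\<omega>. c * X p \<omega>)) E
        = ennreal (1 / 2 * indicator E c + 1 / 2 * indicator E (- c))" if [measurable]: "E \<in> sets borel" for E and c :: complex
    proof -
      let ?F = "{\<omega> \<in> space M. c * X p \<omega> \<in> E}"
      have F: "?F \<in> sets M" by measurable
      have "prob ?F = prob ((?F \<inter> ?A) \<union> (?F \<inter> ?B))"
        using AE F sets by (intro measure_eq_AE) auto
      also have "\<dots> = prob (?F \<inter> ?A) + prob (?F \<inter> ?B)"
        using F sets by (intro finite_measure_Union) auto
      also have "?F \<inter> ?A = (if c \<in> E then ?A else {})" by auto
      also have "?F \<inter> ?B = (if - c \<in> E then ?B else {})" by auto
      finally have "prob ?F = 1 / 2 * indicator E c + 1 / 2 * indicator E (- c)"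
        using prob_prime_1[OF p] prob_prime_minus_1[OF p] by (simp split: if_splits)
      moreover have "emeasure (distr M borel (\<lambda>\<omega>. c * X p \<omega>)) E = ennreal (prob ?F)"
        by (subst emeasure_distr) (auto simp: emeasure_eq_measure vimage_def Int_def conj_commute)
      ultimately show ?thesis by simp
    qed
    show "distr M borel (\<lambda>\<omega>. - X p \<omega>) = distr M borel (X p)"
    proof (rule measure_eqI)
      fix E assume "E \<in> sets (distr M borel (\<lambda>\<omega>. - X p \<omega>))"
      then have "E \<in> sets borel" by simp
      from law[OF this, of "-1"] law[OF this, of 1]
      show "emeasure (distr M borel (\<lambda>\<omega>. - X p \<omega>)) E = emeasure (distr M borel (X p)) E"
        by (simp add: add.commute)
    qed simp
  qed
qed

lemma emeasure_lborel_Ico_shift: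
  fixes a b t :: real
  assumes [measurable]: "E \<in> sets borel"
  shows "emeasure lborel ({a..<b} \<inter> E) = emeasure lborel ({a + t..<b + t} \<inter> {x. x - t \<in> E})"
proof -
  have "emeasure lborel ({a..<b} \<inter> E) = (\<integral>\<^sup>+x. indicator ({a..<b} \<inter> E) x \<partial>lborel)"
    by (subst nn_integral_indicator) auto
  also have "\<dots> = (\<integral>\<^sup>+x. indicator ({a..<b} \<inter> E) (- t + 1 * x) \<partial>lborel)"
    by (subst nn_integral_real_affine[where c = 1 and t = "- t"]) auto
  also have "\<dots> = (\<integral>\<^sup>+x. indicator ({a + t..<b + t} \<inter> {x. x - t \<in> E}) x \<partial>lborel)"
    by (intro nn_integral_cong) (auto simp: indicator_def)
  also have "\<dots> = emeasure lborel ({a + t..<b + t} \<inter> {x. x - t \<in> E})"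
    by (subst nn_integral_indicator) auto
  finally show ?thesis .
qed

lemma e2pi_plus_half: "e2pi (x + 1 / 2) = - e2pi x"
  by (simp add: e2pi_eq_cis ring_distribs cis_mult [symmetric])

lemma e2pi_minus_half: "e2pi (x - 1 / 2) = - e2pi x"
  using e2pi_plus_half[of "x - 1 / 2"] by simp

lemma continuous_on_e2pi: "continuous_on UNIV e2pi"
  unfolding e2pi_def by (intro continuous_intros)

lemma measurable_e2pi [measurable]: "e2pi \<in> borel_measurable borel"
  by (rule borel_measurable_continuous_onI[OF continuous_on_e2pi])

text \<open>Negation on the circle is a shift by \<open>1 / 2\<close>, which exchanges the two
  half-open halves of the unit interval; the endpoint 1 is a null set.\<close>

lemma emeasure_e2pi_uminus:
  assumes [measurable]: "A \<in> sets borel"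
  shows "emeasure lborel ({0..1} \<inter> {x. - e2pi x \<in> A}) = emeasure lborel ({0..1} \<inter> {x. e2pi x \<in> A})"
proof -
  have split: "emeasure lborel ({0..1} \<inter> E)
     = emeasure lborel ({0..<1/2} \<inter> E) + emeasure lborel ({1/2..<1} \<inter> E)" if [measurable]: "E \<in> sets borel" for E :: "real set"
  proof -
    have "emeasure lborel ({0..1} \<inter> E) = emeasure lborel (({0..<1/2} \<inter> E) \<union> ({1/2..<1} \<inter> E))"
    proof (rule emeasure_eq_AE)
      show "AE x in lborel. x \<in> {0..1} \<inter> E \<longleftrightarrow> x \<in> ({0..<1/2} \<inter> E) \<union> ({1/2..<1} \<inter> E)"
        using AE_lborel_singleton[of "1::real"] by eventually_elim auto
    qed auto
    also have "\<dots> = emeasure lborel ({0..<1/2} \<inter> E) + emeasure lborel ({1/2..<1} \<inter> E)"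
      by (rule plus_emeasure [symmetric]) auto
    finally show ?thesis .
  qed
  let ?E = "{x. e2pi x \<in> A}" and ?E' = "{x. - e2pi x \<in> A}"
  have [measurable]: "?E \<in> sets borel" "?E' \<in> sets borel" by measurable
  have "emeasure lborel ({0..<1/2} \<inter> ?E) = emeasure lborel ({1/2..<1} \<inter> ?E')"
    using emeasure_lborel_Ico_shift[of ?E 0 "1/2" "1/2"] by (simp add: e2pi_minus_half)
  moreover have "emeasure lborel ({1/2..<1} \<inter> ?E) = emeasure lborel ({0..<1/2} \<inter> ?E')"
    using emeasure_lborel_Ico_shift[of ?E "1/2" 1 "-1/2"] by (simp add: e2pi_plus_half)
  ultimately show ?thesis by (simp add: split add.commute)
qed

lemma steinhaus_imp_symmetric:
  assumes "steinhaus_multiplicative M X"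
  shows "symmetric_multiplicative M X"
proof -
  interpret steinhaus_multiplicative M X by fact
  let ?U = "uniform_measure lborel {0..1::real}"
  show ?thesis
  proof
    fix p :: nat assume p: "prime p"
    note [measurable] = measurable_prime[OF p]
    have "AE z in distr ?U borel e2pi. norm z = 1"
      by (subst AE_distr_iff) auto
    then have "AE z in distr M borel (X p). norm z = 1"
      unfolding distr_prime[OF p] .
    then show "AE \<omega> in M. norm (X p \<omega>) = 1" by (subst (asm) AE_distr_iff) auto
    have "distr M borel (\<lambda>\<omega>. - X p \<omega>) = distr (distr M borel (X p)) borel uminus"
      by (subst distr_distr) (auto simp: comp_def)
    also have "\<dots> = distr ?U borel (\<lambda>x. - e2pi x)"
      unfolding distr_prime[OF p] by (subst distr_distr) (auto simp: comp_def)
    also have "\<dots> = distr ?U borel e2pi"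
    proof (rule measure_eqI)
      fix A assume "A \<in> sets (distr ?U borel (\<lambda>x. - e2pi x))"
      then have A [measurable]: "A \<in> sets borel" by simp
      have [measurable]: "{x. e2pi x \<in> A} \<in> sets borel" "{x. - e2pi x \<in> A} \<in> sets borel" by measurable
      show "emeasure (distr ?U borel (\<lambda>x. - e2pi x)) A = emeasure (distr ?U borel e2pi) A"
        using emeasure_e2pi_uminus[OF A]
        by (simp add: emeasure_distr vimage_def)
    qed simp
    also have "\<dots> = distr M borel (X p)" by (rule distr_prime[OF p, symmetric])
    finally show "distr M borel (\<lambda>\<omega>. - X p \<omega>) = distr M borel (X p)" .
  qed
qed

section \<open>Bounds for the maximum\<close>

lemma norm_e2pi_diff_le: "norm (e2pi x - e2pi y) \<le> 2 * pi * \<bar>x - y\<bar>"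
proof -
  have "e2pi x - e2pi y = e2pi y * (e2pi (x - y) - 1)"
    by (simp add: ring_distribs e2pi_add [symmetric])
  then have "norm (e2pi x - e2pi y) = norm (e2pi (x - y) - 1)" by (simp add: norm_mult)
  also have "\<dots> = 2 * \<bar>sin (pi * (x - y))\<bar>"
  proof -
    have "e2pi (x - y) = exp (\<i> * of_real (2 * pi * (x - y)))" by (simp add: e2pi_def mult_ac)
    moreover have "2 * pi * (x - y) / 2 = pi * (x - y)" by simp
    ultimately show ?thesis by (simp only: dist_exp_i_1)
  qed
  also have "\<dots> \<le> 2 * \<bar>pi * (x - y)\<bar>" by (intro mult_left_mono abs_sin_x_le_abs_x) auto
  finally show ?thesis by (simp add: abs_mult)
qed

text \<open>Both follow from \<open>N div p \<le> N powr (1 / 4)\<close>. The first makes the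
  correlations negligible against \<open>V^2\<close>, the second keeps the factors of the Riesz
  product within \<open>1 / 2\<close> of 1.\<close>

lemma sum_large_primes_pow4_le:
  assumes "N \<ge> 16"
  shows "(\<Sum>p\<in>large_primes N. real (N div p) ^ 4) \<le> real N powr (3 / 4) * (\<Sum>p\<in>large_primes N. real (N div p))"
    and "p \<in> large_primes N \<Longrightarrow> (real (N div p))\<^sup>2 \<le> sqrt (real N)"
proof -
  have n: "real (N div p) \<le> real N powr (1 / 4)" if "p \<in> large_primes N" for p
  proof (cases "N div p = 0")
    case False
    have "real ((N div p) ^ 4) \<le> real N" using large_primes_div_less[OF assms that] by linarith
    then have "(real (N div p) ^ 4) powr (1 / 4) \<le> real N powr (1 / 4)" by (intro powr_mono2) auto
    also have "(real (N div p) ^ 4) powr (1 / 4) = real (N div p)"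
      using False powr_powr[of "real (N div p)" 4 "1/4"] by simp
    finally show ?thesis .
  qed simp
  have pow: "(real N powr (1 / 4)) ^ m = real N powr (real m / 4)" for m
    using assms by (simp add: powr_power)
  show "(\<Sum>p\<in>large_primes N. real (N div p) ^ 4) \<le> real N powr (3 / 4) * (\<Sum>p\<in>large_primes N. real (N div p))"
    unfolding sum_distrib_left
  proof (rule sum_mono)
    fix p assume "p \<in> large_primes N"
    then have "real (N div p) ^ 3 \<le> real N powr (3 / 4)"
      using power_mono[OF n, of p 3] pow[of 3] by simp
    then have "real (N div p) ^ 3 * real (N div p) \<le> real N powr (3 / 4) * real (N div p)"
      by (intro mult_right_mono) auto
    then show "real (N div p) ^ 4 \<le> real N powr (3 / 4) * real (N div p)"
      by (simp add: eval_nat_numeral mult_ac)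
  qed
  show "(real (N div p))\<^sup>2 \<le> sqrt (real N)" if "p \<in> large_primes N"
    using power_mono[OF n[OF that], of 2] pow[of 2] assms by (simp add: powr_half_sqrt)
qed

text \<open>Markov's inequality for the \<open>2 * k\<close>-th moment at each grid point, then a
  union bound over the \<open>Q\<close> points; the \<open>N ^ k\<close> of the moment cancels
  against \<open>sqrt N ^ (2 * k)\<close>.\<close>

lemma card_flips_large_max_le:
  fixes f :: "nat \<Rightarrow> complex"
  assumes f: "\<And>n. n \<in> {1..N} \<Longrightarrow> norm (f n) = 1" and y: "y > 0" and N: "N > 0"
  defines "I \<equiv> {p. prime p \<and> p \<le> N}"
  shows "real (card {T\<in>Pow I. \<exists>a<Q. sqrt (real N) * y < norm (\<Sum>n=1..N. of_real (flip T n) * (f n * e2pi (real n * (real a / real Q))))})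
    \<le> 2 ^ card I * (real Q * harm N ^ (k * (2 * k + 1)) / y ^ (2 * k))"
proof -
  let ?F = "\<lambda>a T. norm (\<Sum>n=1..N. of_real (flip T n) * (f n * e2pi (real n * (real a / real Q))))"
  define H where "H = (harm N :: real) ^ (k * (2 * k + 1))"
  have finI: "finite I" unfolding I_def by (rule finite_subset[of _ "{..N}"]) auto
  have one: "real (card {T\<in>Pow I. sqrt (real N) * y < ?F a T}) \<le> 2 ^ card I * (H / y ^ (2 * k))" for a
  proof -
    let ?B = "{T\<in>Pow I. sqrt (real N) * y < ?F a T}"
    have "real (card ?B) * (real N ^ k * y ^ (2 * k)) = (\<Sum>T\<in>?B. (sqrt (real N) * y) ^ (2 * k))"
      by (simp add: power_mult_distrib power_mult)
    also have "\<dots> \<le> (\<Sum>T\<in>?B. ?F a T ^ (2 * k))"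
      using y by (intro sum_mono power_mono) auto
    also have "\<dots> \<le> (\<Sum>T\<in>Pow I. ?F a T ^ (2 * k))" using finI by (intro sum_mono2) auto
    also have "\<dots> \<le> 2 ^ card I * real (card (square_lists N (2 * k)))"
      unfolding I_def using f by (intro sum_flip_moment_le) (auto simp: norm_mult)
    also have "\<dots> \<le> 2 ^ card I * (real N ^ k * H)"
      unfolding H_def by (intro mult_left_mono card_square_lists_le) auto
    finally have "real N ^ k * (real (card ?B) * y ^ (2 * k)) \<le> real N ^ k * (2 ^ card I * H)"
      by (simp add: mult_ac)
    then have "real (card ?B) * y ^ (2 * k) \<le> 2 ^ card I * H"
      using N by simp
    then show ?thesis using y by (simp add: field_simps)
  qed
  have "{T\<in>Pow I. \<exists>a<Q. sqrt (real N) * y < ?F a T} = (\<Union>a<Q. {T\<in>Pow I. sqrt (real N) * y < ?F a T})" by auto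
  then have "card {T\<in>Pow I. \<exists>a<Q. sqrt (real N) * y < ?F a T} \<le> (\<Sum>a<Q. card {T\<in>Pow I. sqrt (real N) * y < ?F a T})"
    using card_UN_le[of "{..<Q}" "\<lambda>a. {T\<in>Pow I. sqrt (real N) * y < ?F a T}"] by simp
  then have "real (card {T\<in>Pow I. \<exists>a<Q. sqrt (real N) * y < ?F a T}) \<le> (\<Sum>a<Q. real (card {T\<in>Pow I. sqrt (real N) * y < ?F a T}))"
    by (simp only: of_nat_sum [symmetric] of_nat_le_iff)
  also have "\<dots> \<le> (\<Sum>a<Q. 2 ^ card I * (H / y ^ (2 * k)))" by (intro sum_mono one)
  finally show ?thesis by (simp add: H_def mult_ac)
qed

lemma measurable_norm_sum_PiM:
  fixes c :: "nat \<Rightarrow> complex"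
  shows "(\<lambda>x. norm (\<Sum>n=1..N. x n * c n)) \<in> borel_measurable (Pi\<^sub>M {1..N} (\<lambda>_. borel))"
  by (intro measurable_compose[OF _ borel_measurable_norm] borel_measurable_sum borel_measurable_times borel_measurable_const
      measurable_component_singleton)

lemma sum_restrict_eq:
  "(\<Sum>n=1..N. (\<lambda>n\<in>{1..N}. c n) n * e n) = (\<Sum>n=1..N. c n * (e n :: complex))"
  by (intro sum.cong) auto

lemma norm_rand_poly:
  assumes "N > 0"
  shows "norm (\<Sum>n=1..N. X n \<omega> * e2pi (real n * \<theta>)) = sqrt (real N) * norm (rand_poly X N \<omega> \<theta>)"
  using assms by (simp add: rand_poly_def norm_mult norm_divide)

section \<open>From counting sign patterns to probabilities\<close>

context symmetric_multiplicative
begin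

text \<open>If the maximum is below \<open>L\<close>, then all grid values are below the threshold.
  This is an event \<open>D\<close> in the values \<open>X 1\<close>, ..., \<open>X N\<close>, to
  which \<open>prob_le_flip_average\<close> applies with flips at the large primes.\<close>

lemma prob_small_max_le:
  fixes l \<mu> :: real
  defines "V \<equiv> \<lambda>N. \<Sum>p\<in>large_primes N. real (N div p)" and "B \<equiv> \<lambda>N. \<Sum>p\<in>large_primes N. real (N div p) ^ 4"
  assumes N: "N \<ge> 16" and V: "V N > 0" "64 * B N \<le> (V N)\<^sup>2"
  assumes l: "l > 0" "\<And>p. p \<in> large_primes N \<Longrightarrow> l * real (N div p) \<le> 1 / 2" and mu: "\<mu> > 0"
  assumes L: "sqrt (real N) * L \<le> l * V N / 16 - 1 / l - 2 * sqrt (real N)"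
  shows "prob {\<omega> \<in> space M. max_rand_poly X N \<omega> < L} \<le> 4 * (exp (l\<^sup>2 * V N) * (\<mu> + l ^ 4 * (4 * B N) / \<mu>))"
proof -
  define Q where "Q = 8 * N + 1"
  define Y where "Y = l * V N / 16 - 1 / l - 2 * sqrt (real N)"
  define D where "D = {x \<in> space (Pi\<^sub>M {1..N} (\<lambda>_. borel :: complex measure)).
    \<forall>a\<in>{..<Q}. norm (\<Sum>n=1..N. x n * e2pi (real n * (real a / real Q))) < Y}"
  have D: "D \<in> sets (Pi\<^sub>M {1..N} (\<lambda>_. borel))"
    unfolding D_def using borel_measurable_iff_less[THEN iffD1, OF measurable_norm_sum_PiM]
    by (intro sets.sets_Collect_finite_All') (auto simp: Q_def)
  have "prob {\<omega> \<in> space M. max_rand_poly X N \<omega> < L} \<le> prob {\<omega> \<in> space M. (\<lambda>n\<in>{1..N}. X n \<omega>) \<in> D}"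
  proof (rule finite_measure_mono)
    show "{\<omega> \<in> space M. max_rand_poly X N \<omega> < L} \<subseteq> {\<omega> \<in> space M. (\<lambda>n\<in>{1..N}. X n \<omega>) \<in> D}"
    proof safe
      fix \<omega> assume \<omega>: "\<omega> \<in> space M" "max_rand_poly X N \<omega> < L"
      have "norm (\<Sum>n=1..N. X n \<omega> * e2pi (real n * \<theta>)) < Y" for \<theta>
      proof -
        have "norm (rand_poly X N \<omega> \<theta>) < L"
          using \<omega>(2) max_rand_poly_attained[of X N \<omega>] by (meson le_less_trans)
        then have "sqrt (real N) * norm (rand_poly X N \<omega> \<theta>) < sqrt (real N) * L"
          using N by (intro mult_strict_left_mono) auto
        moreover have "0 < N" using N by simp
        ultimately show ?thesis using L unfolding norm_rand_poly[OF \<open>0 < N\<close>] Y_def by linarith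
      qed
      then show "(\<lambda>n\<in>{1..N}. X n \<omega>) \<in> D"
        unfolding D_def sum_restrict_eq mem_Collect_eq
        by (auto simp: space_PiM PiE_def simp del: times_divide_eq_right One_nat_def)
    qed
    have "(\<lambda>\<omega>. \<lambda>n\<in>{1..N}. X n \<omega>) \<in> measurable M (Pi\<^sub>M {1..N} (\<lambda>_. borel))"
      by (intro measurable_restrict measurable_X) auto
    from measurable_sets[OF this D] show "{\<omega> \<in> space M. (\<lambda>n\<in>{1..N}. X n \<omega>) \<in> D} \<in> sets M"
      by (simp add: vimage_def Int_def conj_commute)
  qed
  also have "\<dots> \<le> 4 * (exp (l\<^sup>2 * V N) * (\<mu> + l ^ 4 * (4 * B N) / \<mu>))"
  proof (rule prob_le_flip_average[OF _ _ _ D, of "large_primes N"])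
    fix f :: "nat \<Rightarrow> complex" assume f: "\<And>n. n \<in> {1..N} \<Longrightarrow> norm (f n) = 1"
    have "{T \<in> Pow (large_primes N). (\<lambda>n\<in>{1..N}. of_real (flip T n) * f n) \<in> D}
        = {T \<in> Pow (large_primes N). \<forall>a<Q. norm (\<Sum>n=1..N. of_real (flip T n) * (f n * e2pi (real n * (real a / real Q)))) < Y}"
      unfolding D_def mem_Collect_eq sum_restrict_eq by (auto simp: space_PiM PiE_def mult.assoc)
    then show "real (card {T \<in> Pow (large_primes N). (\<lambda>n\<in>{1..N}. of_real (flip T n) * f n) \<in> D})
       \<le> 2 ^ card (large_primes N) * (4 * (exp (l\<^sup>2 * V N) * (\<mu> + l ^ 4 * (4 * B N) / \<mu>)))"
      using card_flips_small_max_le[OF N f V[unfolded V_def B_def] l mu]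
      by (simp add: Y_def Q_def V_def B_def)
  qed (use N in \<open>auto simp: large_primes_def\<close>)
  finally show ?thesis .
qed

text \<open>With \<open>t = sqrt (ln N)\<close> and \<open>l^2 = t / V\<close> the exponent
  \<open>l^2 * V\<close> is \<open>t\<close>, and after division by \<open>sqrt N\<close> the
  threshold is at least of order \<open>sqrt t\<close>, the fourth root of \<open>ln N\<close>,
  which beats the exponent \<open>1 / 6\<close>. Up to logarithms the correlation term is
  \<open>N powr (-1/4) / \<mu>\<close>, so \<open>\<mu> = N powr (-1/8)\<close> balances it against
  \<open>\<mu>\<close>.\<close>

lemma eventually_prob_small_max_le:
  "\<forall>\<^sub>F N in sequentially. prob {\<omega> \<in> space M. max_rand_poly X N \<omega> < (ln (real N) / ln (ln (real N))) powr (1 / 6)}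
    \<le> 4 * (exp (sqrt (ln (real N))) * (real N powr (-1/8) + 256 * (sqrt (ln (real N)))\<^sup>2 * real N powr (-1/4) / real N powr (-1/8)))"
proof -
  have ev1: "\<forall>\<^sub>F N::nat in sequentially. (ln (real N) / ln (ln (real N))) powr (1 / 6) \<le> sqrt (sqrt (ln (real N))) / 256 - 2"
    by real_asymp
  have ev2: "\<forall>\<^sub>F N::nat in sequentially. 64 * sqrt (ln (real N)) / sqrt (real N) \<le> 1 / 4" by real_asymp
  have ev3: "\<forall>\<^sub>F N::nat in sequentially. 1024 \<le> sqrt (ln (real N))" by real_asymp
  have ev4: "\<forall>\<^sub>F N::nat in sequentially. 64 * real N powr (3 / 4) \<le> real N / 64" by real_asymp
  show ?thesis using ev1 ev2 ev3 ev4 eventually_sum_large_primes_ge eventually_ge_at_top[of 16]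
  proof eventually_elim
    case (elim N)
    define V where "V = (\<Sum>p\<in>large_primes N. real (N div p))"
    define B where "B = (\<Sum>p\<in>large_primes N. real (N div p) ^ 4)"
    define t where "t = sqrt (ln (real N))"
    define l where "l = sqrt (t / V)"
    define \<mu> where "\<mu> = real N powr (-1/8)"
    have N: "N \<ge> 16" and t: "t \<ge> 1024" using elim by (auto simp: t_def)
    have VN: "real N / 64 \<le> V" using elim by (simp add: V_def)
    have V: "V > 0" using VN N by (intro less_le_trans[OF _ VN]) auto
    have B: "B \<le> real N powr (3 / 4) * V" unfolding B_def V_def by (rule sum_large_primes_pow4_le[OF N])
    have "64 * B \<le> 64 * real N powr (3 / 4) * V" using B by simp
    also have "\<dots> \<le> V * V" using elim VN V by (intro mult_right_mono) auto
    finally have BV: "64 * B \<le> V\<^sup>2" by (simp add: power2_eq_square)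
    have l0: "l > 0" using t V by (simp add: l_def)
    have l2: "l\<^sup>2 = t / V" using t V by (simp add: l_def)
    have lV: "l\<^sup>2 * V = t" using V by (simp add: l2)
    have small: "l * real (N div p) \<le> 1 / 2" if p: "p \<in> large_primes N" for p
    proof -
      have "(l * real (N div p))\<^sup>2 = t / V * (real (N div p))\<^sup>2" by (simp add: power_mult_distrib l2)
      also have "\<dots> \<le> t / (real N / 64) * sqrt (real N)"
        using sum_large_primes_pow4_le(2)[OF N p] VN t N V by (intro mult_mono divide_left_mono) auto
      also have "\<dots> = 64 * t / sqrt (real N)" using N by (simp add: field_simps)
      also have "\<dots> \<le> (1 / 2)\<^sup>2" using elim by (simp add: t_def power2_eq_square)
      finally show ?thesis by (rule power2_le_imp_le) simp
    qed
    have L: "sqrt (real N) * (ln (real N) / ln (ln (real N))) powr (1 / 6) \<le> l * V / 16 - 1 / l - 2 * sqrt (real N)"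
    proof -
      have st: "sqrt t \<ge> 32" using real_sqrt_le_mono[OF t] by (simp add: real_sqrt_eq_iff)
      have lV': "l * V = sqrt V * sqrt t" "1 / l = sqrt V / sqrt t"
        using V t by (simp_all add: l_def real_sqrt_divide field_simps flip: power2_eq_square)
      \<comment> \<open>Thus the loss \<open>1 / l\<close> takes at most half of the main term
        \<open>l * V / 16\<close>.\<close>
      have "1 / sqrt t \<le> sqrt t / 32" using st t by (simp add: field_simps flip: power2_eq_square)
      then have "sqrt V * (1 / sqrt t) \<le> sqrt V * (sqrt t / 32)" using V by (intro mult_left_mono) auto
      then have 1: "sqrt V * sqrt t / 32 \<le> l * V / 16 - 1 / l" unfolding lV' by simp
      \<comment> \<open>Replacing \<open>V\<close> by \<open>N / 64\<close> costs a factor 8, whence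
        the constant \<open>1 / 256 = 1 / (8 * 32)\<close>.\<close>
      have "sqrt (real N / 64) \<le> sqrt V" using VN by simp
      then have "sqrt (real N) / 8 \<le> sqrt V" by (simp add: real_sqrt_divide)
      then have "sqrt (real N) / 8 * sqrt t \<le> sqrt V * sqrt t" using t by (intro mult_right_mono) auto
      with 1 have "sqrt (real N) * (sqrt t / 256) \<le> l * V / 16 - 1 / l" by simp
      moreover have "sqrt (real N) * (ln (real N) / ln (ln (real N))) powr (1 / 6) \<le> sqrt (real N) * (sqrt t / 256 - 2)"
        using elim by (intro mult_left_mono) (auto simp: t_def)
      ultimately show ?thesis by (simp add: algebra_simps)
    qed
    have "prob {\<omega> \<in> space M. max_rand_poly X N \<omega> < (ln (real N) / ln (ln (real N))) powr (1 / 6)}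
        \<le> 4 * (exp (l\<^sup>2 * V) * (\<mu> + l ^ 4 * (4 * B) / \<mu>))"
      unfolding V_def B_def
      by (rule prob_small_max_le) (use N V BV l0 small L in \<open>auto simp: \<mu>_def V_def B_def\<close>)
    also have "\<dots> \<le> 4 * (exp t * (\<mu> + 256 * t\<^sup>2 * real N powr (-1/4) / \<mu>))"
    proof -
      have "l ^ 4 * (4 * B) = (l\<^sup>2)\<^sup>2 * (4 * B)" by simp
      also have "\<dots> = 4 * t\<^sup>2 * (B / V\<^sup>2)" unfolding l2 by (simp add: power_divide)
      also have "B / V\<^sup>2 \<le> real N powr (3 / 4) * V / V\<^sup>2" using B V by (intro divide_right_mono) auto
      also have "\<dots> = real N powr (3 / 4) / V" using V by (simp add: power2_eq_square)
      also have "\<dots> \<le> real N powr (3 / 4) / (real N / 64)" using V VN N by (intro divide_left_mono) auto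
      also have "\<dots> = 64 * real N powr (-1/4)"
        using N powr_diff[of "real N" "3/4" 1] by simp
      finally have "l ^ 4 * (4 * B) \<le> 256 * t\<^sup>2 * real N powr (-1/4)"
        by (simp add: mult_left_mono)
      then show ?thesis unfolding lV
        by (intro mult_left_mono add_left_mono divide_right_mono) (auto simp: \<mu>_def)
    qed
    finally show ?case unfolding t_def \<mu>_def .
  qed
qed

text \<open>Discretisation: some grid point is within \<open>1 / N^2\<close> of the maximiser, so
  each of the \<open>N\<close> terms changes by at most \<open>8 / N\<close>, and the sum by at most
  \<open>8 \<le> sqrt N\<close>. After normalisation this is the 1 in \<open>y + 1\<close>; the grid
  values are then controlled by the moments.\<close>

lemma prob_large_max_le:
  assumes N: "N \<ge> 64" and y: "y > 0"
  shows "prob {\<omega> \<in> space M. y + 1 < max_rand_poly X N \<omega>} \<le> real (N\<^sup>2) * harm N ^ (k * (2 * k + 1)) / y ^ (2 * k)"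
proof -
  define Q where "Q = N\<^sup>2"
  define D where "D = {x \<in> space (Pi\<^sub>M {1..N} (\<lambda>_. borel :: complex measure)).
    \<exists>a\<in>{..<Q}. sqrt (real N) * y < norm (\<Sum>n=1..N. x n * e2pi (real n * (real a / real Q)))}"
  have Q0: "Q > 0" using N by (simp add: Q_def)
  have D: "D \<in> sets (Pi\<^sub>M {1..N} (\<lambda>_. borel))"
    unfolding D_def using borel_measurable_iff_greater[THEN iffD1, OF measurable_norm_sum_PiM]
    by (intro sets.sets_Collect_finite_Ex) auto
  have "prob {\<omega> \<in> space M. y + 1 < max_rand_poly X N \<omega>} \<le> prob {\<omega> \<in> space M. (\<lambda>n\<in>{1..N}. X n \<omega>) \<in> D}"
  proof (rule finite_measure_mono_AE)
    show "AE \<omega> in M. \<omega> \<in> {\<omega> \<in> space M. y + 1 < max_rand_poly X N \<omega>} \<longrightarrow> \<omega> \<in> {\<omega> \<in> space M. (\<lambda>n\<in>{1..N}. X n \<omega>) \<in> D}"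
      using AE_norm_X
    proof (rule AE_mp, intro AE_I2 impI)
      fix \<omega> assume "\<omega> \<in> space M" "\<forall>n>0. norm (X n \<omega>) = 1"
        and "\<omega> \<in> {\<omega> \<in> space M. y + 1 < max_rand_poly X N \<omega>}"
      then have \<omega>: "\<omega> \<in> space M" "\<forall>n>0. norm (X n \<omega>) = 1" "y + 1 < max_rand_poly X N \<omega>" by auto
      obtain \<theta>' where "norm (rand_poly X N \<omega> \<theta>') = max_rand_poly X N \<omega>"
        using max_rand_poly_attained[of X N \<omega>] by blast
      then have \<theta>: "norm (rand_poly X N \<omega> (frac \<theta>')) > y + 1" using \<omega>(3) by (simp add: rand_poly_frac)
      define \<theta> where "\<theta> = frac \<theta>'"
      have \<theta>01: "0 \<le> \<theta>" "\<theta> < 1" by (auto simp: \<theta>_def frac_lt_1)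
      define a where "a = nat \<lfloor>\<theta> * real Q\<rfloor>"
      have a: "real a \<le> \<theta> * real Q" "\<theta> * real Q < real a + 1"
        unfolding a_def using \<theta>01 by (auto intro!: of_nat_floor) 
      have "\<theta> * real Q < real Q" using \<theta>01 Q0 by simp
      then have aQ: "a < Q" using a by linarith
      have d: "\<bar>\<theta> - real a / real Q\<bar> \<le> 1 / real Q" 
      proof -
        have "real a / real Q \<le> \<theta>" "\<theta> \<le> (real a + 1) / real Q"
          using a Q0 by (simp_all add: divide_le_eq le_divide_eq)
        then show ?thesis unfolding add_divide_distrib by linarith
      qed
      define z where "z = (\<lambda>\<theta>. \<Sum>n=1..N. X n \<omega> * e2pi (real n * \<theta>))"
      have "norm (z \<theta> - z (real a / real Q)) \<le> (\<Sum>n=1..N. 8 * real N / real Q)"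
        unfolding z_def sum_subtractf [symmetric]
      proof (rule sum_norm_le)
        fix n assume n: "n \<in> {1..N}"
        have "norm (X n \<omega> * e2pi (real n * \<theta>) - X n \<omega> * e2pi (real n * (real a / real Q)))
           = norm (e2pi (real n * \<theta>) - e2pi (real n * (real a / real Q)))"
          using \<omega>(2) n by (simp add: right_diff_distrib [symmetric] norm_mult)
        also have "\<dots> \<le> 2 * pi * \<bar>real n * \<theta> - real n * (real a / real Q)\<bar>" by (rule norm_e2pi_diff_le)
        also have "\<dots> = 2 * pi * (real n * \<bar>\<theta> - real a / real Q\<bar>)"
          unfolding right_diff_distrib [symmetric] abs_mult by simp
        also have "\<dots> \<le> 8 * (real N * (1 / real Q))"
          using d n pi_less_4 by (intro mult_mono) auto
        finally show "norm (X n \<omega> * e2pi (real n * \<theta>) - X n \<omega> * e2pi (real n * (real a / real Q))) \<le> 8 * real N / real Q"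
          by simp
      qed
      also have "\<dots> = 8" using N by (simp add: Q_def power2_eq_square)
      also have "\<dots> \<le> sqrt (real N)" using N by (intro real_le_rsqrt) auto
      finally have "norm (z \<theta> - z (real a / real Q)) \<le> sqrt (real N)" .
      moreover have "norm (z \<theta>) \<le> norm (z (real a / real Q)) + norm (z \<theta> - z (real a / real Q))"
        using norm_triangle_ineq[of "z (real a / real Q)" "z \<theta> - z (real a / real Q)"] by simp
      moreover have "norm (z \<theta>) > sqrt (real N) * (y + 1)"
      proof -
        have "0 < N" using N by simp
        then show ?thesis using \<theta> unfolding z_def norm_rand_poly[OF \<open>0 < N\<close>] \<theta>_def by simp
      qed
      ultimately have "sqrt (real N) * y < norm (z (real a / real Q))" by (simp add: algebra_simps)
      then show "\<omega> \<in> {\<omega> \<in> space M. (\<lambda>n\<in>{1..N}. X n \<omega>) \<in> D}"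
        using \<omega>(1) aQ unfolding D_def sum_restrict_eq mem_Collect_eq z_def
        by (auto simp: space_PiM PiE_def simp del: times_divide_eq_right One_nat_def)
    qed
    have "(\<lambda>\<omega>. \<lambda>n\<in>{1..N}. X n \<omega>) \<in> measurable M (Pi\<^sub>M {1..N} (\<lambda>_. borel))"
      by (intro measurable_restrict measurable_X) auto
    from measurable_sets[OF this D] show "{\<omega> \<in> space M. (\<lambda>n\<in>{1..N}. X n \<omega>) \<in> D} \<in> sets M"
      by (simp add: vimage_def Int_def conj_commute)
  qed
  also have "\<dots> \<le> real Q * harm N ^ (k * (2 * k + 1)) / y ^ (2 * k)"
  proof (rule prob_le_flip_average[OF _ _ _ D, of "{p. prime p \<and> p \<le> N}"])
    fix f :: "nat \<Rightarrow> complex" assume f: "\<And>n. n \<in> {1..N} \<Longrightarrow> norm (f n) = 1"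
    have "{T \<in> Pow {p. prime p \<and> p \<le> N}. (\<lambda>n\<in>{1..N}. of_real (flip T n) * f n) \<in> D}
        = {T \<in> Pow {p. prime p \<and> p \<le> N}. \<exists>a<Q. sqrt (real N) * y < norm (\<Sum>n=1..N. of_real (flip T n) * (f n * e2pi (real n * (real a / real Q))))}"
      unfolding D_def mem_Collect_eq sum_restrict_eq by (auto simp: space_PiM PiE_def mult.assoc)
    then show "real (card {T \<in> Pow {p. prime p \<and> p \<le> N}. (\<lambda>n\<in>{1..N}. of_real (flip T n) * f n) \<in> D})
       \<le> 2 ^ card {p. prime p \<and> p \<le> N} * (real Q * harm N ^ (k * (2 * k + 1)) / y ^ (2 * k))"
      using card_flips_large_max_le[OF f y] N by simp
  qed (use N in auto)
  finally show ?thesis unfolding Q_def .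
qed

text \<open>Take \<open>k = \<lfloor>x\<rfloor>\<close> with
  \<open>x = sqrt (ln N / ln (ln N))\<close>. To leading order the moment costs
  \<open>2 * x^2 * ln (ln N) = 2 * ln N\<close> in the exponent, the \<open>N^2\<close> grid points
  cost another \<open>2 * ln N\<close>, and \<open>y ^ (2 * k)\<close> gains
  \<open>6 * ln N\<close>.\<close>

lemma eventually_prob_large_max_le:
  "\<forall>\<^sub>F N in sequentially. prob {\<omega> \<in> space M. exp (3 * sqrt (ln (real N) * ln (ln (real N)))) < max_rand_poly X N \<omega>}
    \<le> exp (2 * ln (real N) + sqrt (ln (real N) / ln (ln (real N))) * (2 * sqrt (ln (real N) / ln (ln (real N))) + 1) * ln (1 + ln (real N))
       - 2 * (sqrt (ln (real N) / ln (ln (real N))) - 1) * (3 * sqrt (ln (real N) * ln (ln (real N))) - 1))"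
proof -
  have ev1: "\<forall>\<^sub>F N::nat in sequentially. 1 \<le> 3 * sqrt (ln (real N) * ln (ln (real N)))" by real_asymp
  have ev2: "\<forall>\<^sub>F N::nat in sequentially. 1 \<le> sqrt (ln (real N) / ln (ln (real N)))" by real_asymp
  show ?thesis using ev1 ev2 eventually_ge_at_top[of 64]
  proof eventually_elim
    case (elim N)
    define x where "x = sqrt (ln (real N) / ln (ln (real N)))"
    define s where "s = 3 * sqrt (ln (real N) * ln (ln (real N)))"
    define k where "k = nat \<lfloor>x\<rfloor>"
    define y where "y = exp s - 1"
    have N: "N \<ge> 64" and x: "x \<ge> 1" and s: "s \<ge> 1" using elim by (auto simp: x_def s_def)
    have k: "real k \<le> x" "x - 1 \<le> real k"
      unfolding k_def using x by (auto intro!: of_nat_floor)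
    have lnN: "ln (real N) \<ge> 0" using N by simp
    \<comment> \<open>Subtracting 1 for the discretisation costs at most one unit in the exponent,
      since \<open>exp 1 \<ge> 2\<close> and \<open>s \<ge> 1\<close>.\<close>
    have y: "exp (s - 1) \<le> y"
    proof -
      have "2 * exp (s - 1) \<le> exp 1 * exp (s - 1)"
        using exp_ge_add_one_self[of 1] by (intro mult_right_mono) auto
      also have "\<dots> = exp s" by (simp add: exp_add [symmetric])
      finally have "2 * exp (s - 1) \<le> exp s" .
      moreover have "1 \<le> exp (s - 1)" using s by simp
      ultimately show ?thesis unfolding y_def by linarith
    qed
    then have y0: "y > 0" by (rule less_le_trans[OF exp_gt_zero])
    have "prob {\<omega> \<in> space M. exp s < max_rand_poly X N \<omega>} = prob {\<omega> \<in> space M. y + 1 < max_rand_poly X N \<omega>}"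
      by (simp add: y_def)
    also have "\<dots> \<le> real (N\<^sup>2) * harm N ^ (k * (2 * k + 1)) / y ^ (2 * k)"
      by (rule prob_large_max_le[OF N y0])
    also have "\<dots> \<le> exp (2 * ln (real N)) * exp (x * (2 * x + 1) * ln (1 + ln (real N))) / exp (2 * (x - 1) * (s - 1))"
    proof (intro frac_le mult_mono)
      show "real (N\<^sup>2) \<le> exp (2 * ln (real N))"
        using N by (simp add: exp_double)
      have "harm N \<le> 1 + ln (real N)"
        using euler_mascheroni_sequence_decreasing[of 1 N] N by (simp add: harm_def)
      then have "harm N ^ (k * (2 * k + 1)) \<le> (1 + ln (real N)) ^ (k * (2 * k + 1))"
        by (intro power_mono harm_nonneg)
      also have "\<dots> = exp (real (k * (2 * k + 1)) * ln (1 + ln (real N)))"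
        using lnN by (subst exp_of_nat_mult) simp
      also have "\<dots> \<le> exp (x * (2 * x + 1) * ln (1 + ln (real N)))"
      proof -
        have "real (k * (2 * k + 1)) = real k * (2 * real k + 1)" by (simp add: algebra_simps)
        also have "\<dots> \<le> x * (2 * x + 1)" using k x by (intro mult_mono) auto
        finally show ?thesis using lnN by (subst exp_le_cancel_iff, intro mult_right_mono) auto
      qed
      finally show "harm N ^ (k * (2 * k + 1)) \<le> exp (x * (2 * x + 1) * ln (1 + ln (real N)))" .
      have "exp (2 * (x - 1) * (s - 1)) \<le> exp (2 * real k * (s - 1))"
        using k s by (subst exp_le_cancel_iff, intro mult_right_mono) auto
      also have "\<dots> = exp (s - 1) ^ (2 * k)" by (simp add: exp_of_nat_mult [symmetric])
      also have "\<dots> \<le> y ^ (2 * k)" using y by (intro power_mono) auto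
      finally show "exp (2 * (x - 1) * (s - 1)) \<le> y ^ (2 * k)" .
    qed (auto simp: harm_nonneg)
    also have "\<dots> = exp (2 * ln (real N) + x * (2 * x + 1) * ln (1 + ln (real N)) - 2 * (x - 1) * (s - 1))"
      by (simp add: exp_add exp_diff)
    finally show ?case unfolding x_def s_def .
  qed
qed

lemma prob_max_tendsto_1:
  "(\<lambda>N. prob {\<omega> \<in> space M. (ln (real N) / ln (ln (real N))) powr (1 / 6) \<le> max_rand_poly X N \<omega> \<and>
      max_rand_poly X N \<omega> \<le> exp (3 * sqrt (ln (real N) * ln (ln (real N))))}) \<longlonglongrightarrow> 1"
proof -
  let ?L = "\<lambda>N::nat. (ln (real N) / ln (ln (real N))) powr (1 / 6)"
  let ?U = "\<lambda>N::nat. exp (3 * sqrt (ln (real N) * ln (ln (real N))))"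
  let ?e1 = "\<lambda>N::nat. 4 * (exp (sqrt (ln (real N))) * (real N powr (-1/8) + 256 * (sqrt (ln (real N)))\<^sup>2 * real N powr (-1/4) / real N powr (-1/8)))"
  let ?e2 = "\<lambda>N::nat. exp (2 * ln (real N) + sqrt (ln (real N) / ln (ln (real N))) * (2 * sqrt (ln (real N) / ln (ln (real N))) + 1) * ln (1 + ln (real N))
       - 2 * (sqrt (ln (real N) / ln (ln (real N))) - 1) * (3 * sqrt (ln (real N) * ln (ln (real N))) - 1))"
  let ?G = "\<lambda>N. {\<omega> \<in> space M. ?L N \<le> max_rand_poly X N \<omega> \<and> max_rand_poly X N \<omega> \<le> ?U N}"
  have e1: "?e1 \<longlonglongrightarrow> 0" by real_asymp
  \<comment> \<open>The exponent is \<open>(2 + 2 - 6) * ln N\<close> to leading order; here the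
    constant 3 of the upper bound leaves a margin.\<close>
  have e2: "?e2 \<longlonglongrightarrow> 0"
    by (rule filterlim_compose[OF exp_at_bot]) real_asymp
  have "(\<lambda>N. 1 - (?e1 N + ?e2 N)) \<longlonglongrightarrow> 1 - (0 + 0)"
    by (intro tendsto_intros e1 e2)
  then have lim: "(\<lambda>N. 1 - (?e1 N + ?e2 N)) \<longlonglongrightarrow> 1" by simp
  show ?thesis
  proof (rule tendsto_sandwich[OF _ _ lim tendsto_const])
    show "\<forall>\<^sub>F N in sequentially. 1 - (?e1 N + ?e2 N) \<le> prob (?G N)"
      using eventually_prob_small_max_le eventually_prob_large_max_le
    proof eventually_elim
      case (elim N)
      note [measurable] = measurable_max_rand_poly[of N]
      let ?A = "{\<omega> \<in> space M. max_rand_poly X N \<omega> < ?L N}" and ?B = "{\<omega> \<in> space M. ?U N < max_rand_poly X N \<omega>}"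
      have sets: "?A \<in> sets M" "?B \<in> sets M" "?G N \<in> sets M" by measurable
      have "space M = ?G N \<union> (?A \<union> ?B)" by auto
      then have "1 = prob (?G N \<union> (?A \<union> ?B))" using prob_space by simp
      also have "\<dots> \<le> prob (?G N) + prob (?A \<union> ?B)" using sets by (intro measure_Un_le) auto
      also have "prob (?A \<union> ?B) \<le> prob ?A + prob ?B" using sets by (intro measure_Un_le) auto
      finally show ?case using elim by linarith
    qed
  qed (simp add: prob_le_1)
qed

end

theorem theorem1p3:
  fixes M :: "'a measure" and X :: "nat \<Rightarrow> 'a \<Rightarrow> complex"
  assumes "rademacher_multiplicative M X \<or> steinhaus_multiplicative M X"
  shows "(\<lambda>N. measure M {\<omega> \<in> space M.
            (ln (real N) / ln (ln (real N))) powr (1 / 6) \<le> max_rand_poly X N \<omega> \<and>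
            max_rand_poly X N \<omega> \<le> exp (3 * sqrt (ln (real N) * ln (ln (real N))))})
          \<longlonglongrightarrow> 1"
proof -
  from assms have "symmetric_multiplicative M X"
    using rademacher_imp_symmetric steinhaus_imp_symmetric by blast
  then show ?thesis by (rule symmetric_multiplicative.prob_max_tendsto_1)
qed

end
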